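(* Let $0<\lambda\le\Lambda$ and let $\Omega\subset\mathbb{R}^n$ be a domain that satisfies the anti-exterior $C^{1,\mathrm{Dini}}$ condition at $0\in\partial\Omega$, with corresponding function $\omega_\Omega$. Then there exist $\delta>0$ and a function $\tilde\omega:(0,\delta)\to(0,+\infty)$ with $\tilde\omega(r)\to+\infty$ as $r\to0$, both depending only on $n,\lambda,\Lambda$ and $\omega_\Omega$, such that the following holds. If $u$ satisfies $$\mathcal{M}^-(D^2u,\lambda,\Lambda)\le0\ \text{ in }\ \Omega\cap B_1\quad(\text{i.e., } u\in\bar S(\lambda,\Lambda,0) \text{ in }\Omega\cap B_1),$$ with $u(0)=0$ and $u\ge0$ in $\Omega\cap B_1$, then for any $l=(l_1,\dots,l_n)\in\mathbb{R}^n$ with $|l|=1$ and $l_n>0$, $$u(rl)\ge l_n\left(\inf_{x\in B_{1/8}(e_n/2)}u(x)\right)r\,\tilde\omega(r)\qquad\text{for all } 0<r<\delta.$$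
   Context: Notation: $B_r(x_0)$ is the open ball of radius $r$ centered at $x_0$ in $\mathbb{R}^n$, $B_r=B_r(0)$; $x=(x',x_n)$ with $x'\in\mathbb{R}^{n-1}$; $e_n=(0,\dots,0,1)$. Anti-exterior $C^{1,\mathrm{Dini}}$ condition at $0\in\partial\Omega$: there exist $r_0>0$, a coordinate system $\{x_1,\dots,x_n\}$ with origin at the boundary point $0$, and a nondecreasing function $\omega_\Omega:[0,+\infty)\to[0,+\infty)$ such that $$B_{r_0}\cap\{x_n>-|x'|\omega_\Omega(|x'|)\}\subset B_{r_0}\cap\Omega,$$ where $\omega_\Omega(r)\to0$ as $r\to0$ and $\omega_\Omega$ does not satisfy the Dini condition, i.e. $\int_0^{r_0}\frac{\omega_\Omega(r)}{r}\,dr=+\infty$. It is assumed throughout that $r_0=1$ and $\omega_\Omega(1)<1/4$. The claim is expressed in this coordinate system. Pucci extremal operator: for a symmetric $n\times n$ matrix $M$ with eigenvalues $\lambda_1,\dots,\lambda_n$, $$\mathcal{M}^-(M,\lambda,\Lambda)=\lambda\sum_{\lambda_i>0}\lambda_i+\Lambda\sum_{\lambda_i<0}\lambda_i.$$ Pucci class: for $D\subset\mathbb{R}^n$ open, $u\in\bar S(\lambda,\Lambda,0)$ in $D$ (also written $\mathcal{M}^-(D^2u,\lambda,\Lambda)\le0$ in $D$) means that $u\in C(D)$ is an $L^n$-viscosity supersolution of $\mathcal{M}^-(D^2u,\lambda,\Lambda)=0$ in $D$: whenever $\varphi\in W^{2,n}(D)$ and $u-\varphi$ attains a local minimum at $x\in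 D$, one has $\mathrm{ess}\liminf_{y\to x}\mathcal{M}^-(D^2\varphi(y),\lambda,\Lambda)\le0$. *)

theory Defs
  imports "HOL-Analysis.Analysis"
begin

definition eigenspace :: "real^'n^'n \<Rightarrow> real \<Rightarrow> (real^'n) set" where
  "eigenspace M \<mu> = {v. M *v v = \<mu> *\<^sub>R v}"

definition eigenvalues :: "real^'n^'n \<Rightarrow> real set" where
  "eigenvalues M = {\<mu>. \<exists>v. v \<noteq> 0 \<and> v \<in> eigenspace M \<mu>}"

(* Intended for symmetric M. The eigenvalues \<lambda>_1, ..., \<lambda>_n are listed with multiplicity, so each
   distinct eigenvalue is weighted by the dimension of its eigenspace (for symmetric M the
   geometric and algebraic multiplicities agree). *)
definition pucci_min :: "real \<Rightarrow> real \<Rightarrow> real^'n^'n \<Rightarrow> real" where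
  "pucci_min lam Lam M =
     lam * (\<Sum>\<mu>\<in>{\<mu>\<in>eigenvalues M. \<mu> > 0}. real (dim (eigenspace M \<mu>)) * \<mu>) +
     Lam * (\<Sum>\<mu>\<in>{\<mu>\<in>eigenvalues M. \<mu> < 0}. real (dim (eigenspace M \<mu>)) * \<mu>)"

definition partial_deriv :: "'n \<Rightarrow> (real^'n \<Rightarrow> real) \<Rightarrow> real^'n \<Rightarrow> real" where
  "partial_deriv i f x = frechet_derivative f (at x) (axis i 1)"

fun Ck_function :: "nat \<Rightarrow> (real^'n \<Rightarrow> real) \<Rightarrow> bool" where
  "Ck_function 0 f \<longleftrightarrow> continuous_on UNIV f"
| "Ck_function (Suc k) f \<longleftrightarrow>
     (\<forall>x. f differentiable (at x)) \<and> (\<forall>i. Ck_function k (partial_deriv i f))"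

definition test_function :: "(real^'n) set \<Rightarrow> (real^'n \<Rightarrow> real) \<Rightarrow> bool" where
  "test_function D \<psi> \<longleftrightarrow>
     (\<forall>k. Ck_function k \<psi>) \<and>
     compact (closure (support_on UNIV \<psi>)) \<and> closure (support_on UNIV \<psi>) \<subseteq> D"

definition in_Lp :: "nat \<Rightarrow> (real^'n) set \<Rightarrow> (real^'n \<Rightarrow> real) \<Rightarrow> bool" where
  "in_Lp p D f \<longleftrightarrow>
     f \<in> borel_measurable (lebesgue_on D) \<and> integrable (lebesgue_on D) (\<lambda>x. \<bar>f x\<bar> ^ p)"

(* g is the i-th weak partial derivative of f in D. Only meaningful for f and g locally
   integrable in the open set D; this always holds below, where both lie in L^p. *)
definition weak_partial ::
  "(real^'n) set \<Rightarrow> 'n \<Rightarrow> (real^'n \<Rightarrow> real) \<Rightarrow> (real^'n \<Rightarrow> real) \<Rightarrow> bool" where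
  "weak_partial D i f g \<longleftrightarrow>
     (\<forall>\<psi>. test_function D \<psi> \<longrightarrow>
        (LINT x|lebesgue_on D. f x * partial_deriv i \<psi> x) =
        - (LINT x|lebesgue_on D. g x * \<psi> x))"

(* \<phi> belongs to W^{2,p}(D) and H is a representative of its weak Hessian. *)
definition W2p_with_hessian ::
  "nat \<Rightarrow> (real^'n) set \<Rightarrow> (real^'n \<Rightarrow> real) \<Rightarrow> (real^'n \<Rightarrow> real^'n^'n) \<Rightarrow> bool" where
  "W2p_with_hessian p D \<phi> H \<longleftrightarrow>
     in_Lp p D \<phi> \<and>
     (\<exists>G :: real^'n \<Rightarrow> real^'n.
        (\<forall>i. in_Lp p D (\<lambda>x. G x $ i) \<and> weak_partial D i \<phi> (\<lambda>x. G x $ i)) \<and>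
        (\<forall>i j. in_Lp p D (\<lambda>x. H x $ i $ j) \<and>
               weak_partial D j (\<lambda>x. G x $ i) (\<lambda>x. H x $ i $ j)))"

(* The Liminf along this filter ignores null sets: it is the supremum over neighbourhoods U of x
   of the essential infimum of g on U. *)
definition ess_liminf_at :: "real^'n \<Rightarrow> (real^'n \<Rightarrow> real) \<Rightarrow> ereal" where
  "ess_liminf_at x g = Liminf (inf (nhds x) (ae_filter lebesgue)) (\<lambda>y. ereal (g y))"

(* u is an L^n-viscosity supersolution of M^-(D^2 u, lam, Lam) = 0 in the open set D, i.e.
   u belongs to the class S-bar(lam, Lam, 0) in D. Elements of W^{2,n}(D) have a continuous
   representative, and it is this one that is compared pointwise with u, whence the continuity
   requirement on \<phi>. The weak Hessian H is determined (and symmetric) almost everywhere, and the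
   essential lower limit does not depend on the representative. *)
definition pucci_supersolution ::
  "real \<Rightarrow> real \<Rightarrow> (real^'n) set \<Rightarrow> (real^'n \<Rightarrow> real) \<Rightarrow> bool" where
  "pucci_supersolution lam Lam D u \<longleftrightarrow>
     continuous_on D u \<and>
     (\<forall>\<phi> H x.
        continuous_on D \<phi> \<and> W2p_with_hessian CARD('n) D \<phi> H \<and>
        x \<in> D \<and> (\<forall>\<^sub>F y in at x within D. u x - \<phi> x \<le> u y - \<phi> y) \<longrightarrow>
        ess_liminf_at x (\<lambda>y. pucci_min lam Lam (H y)) \<le> 0)"

(* The anti-exterior C^{1,Dini} condition at the origin. The unit vector e is the n-th basis
   vector of the orthonormal coordinate system of the condition, so that x_n = x \<bullet> e and
   x' corresponds to x - (x \<bullet> e) e; nothing depends on the other basis vectors. *)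
definition anti_exterior_C1Dini ::
  "real^'n \<Rightarrow> real \<Rightarrow> (real \<Rightarrow> real) \<Rightarrow> (real^'n) set \<Rightarrow> bool" where
  "anti_exterior_C1Dini e r0 \<omega> \<Omega> \<longleftrightarrow>
     norm e = 1 \<and> r0 > 0 \<and>
     mono_on {0..} \<omega> \<and> (\<forall>r\<ge>0. \<omega> r \<ge> 0) \<and> (\<omega> \<longlongrightarrow> 0) (at_right 0) \<and>
     (\<integral>\<^sup>+r. ennreal (\<omega> r / r) * indicator {0<..<r0} r \<partial>lborel) = \<infinity> \<and>
     ball 0 r0 \<inter>
       {x. x \<bullet> e > - norm (x - (x \<bullet> e) *\<^sub>R e) * \<omega> (norm (x - (x \<bullet> e) *\<^sub>R e))}
       \<subseteq> ball 0 r0 \<inter> \<Omega>"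

end

theory Submission
  imports Defs
begin

text \<open>
  All barriers are quadratic. With \<open>t\<close> the coordinate of \<open>x - z\<close> along a unit vector \<open>d\<close> and \<open>\<xi>\<close> the length
  of its orthogonal part, \<open>\<theta> t\<^sup>2 - \<xi>\<^sup>2\<close> is a strict subsolution of the Pucci operator when
  \<open>\<theta> = n \<Lambda> / \<lambda>\<close>, and so is its sum with any affine function. Hence \<open>u\<close> cannot be touched from below
  by such functions on cylinders with axis \<open>d\<close>. This comparison survives subtraction of linear
  functions from \<open>u\<close>, and it yields both a chain-of-balls bound for nonnegative \<open>u\<close> and the
  Hopf lemma in a half ball.

  If \<open>u \<ge> a x\<^sub>n\<close> in the upper half of \<open>B\<^sub>R\<close>, then \<open>v = u - a x\<^sub>n\<close> is nonnegative also below \<open>{x\<^sub>n = 0}\<close>, and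
  at depth of order \<open>R \<omega>(R/4)\<close>, which \<open>\<Omega>\<close> contains at horizontal distance about \<open>R/2\<close> from the origin, \<open>v\<close> is at
  least of order \<open>a R \<omega>(R/4)\<close>. Propagating this bound to the half ball and applying the Hopf
  lemma to \<open>v\<close> improves the slope \<open>a\<close> by a factor \<open>1 + c \<omega>(R/4)\<close> in the half ball of radius \<open>\<eta> R\<close>.
  Along \<open>R\<^sub>k = \<eta>\<^sup>k R\<^sub>0\<close> the product of these factors diverges, because the Dini integral does.
\<close>

section \<open>Axial coordinates, cylinders and comparison with saddles\<close>

definition perp :: "'a::real_inner \<Rightarrow> 'a \<Rightarrow> 'a" where
  "perp d x = x - (x \<bullet> d) *\<^sub>R d"

lemma perp_scaleR: "perp d (R *\<^sub>R x) = R *\<^sub>R perp d x"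
  by (simp add: perp_def algebra_simps)

lemma perp_add: "perp d (x + y) = perp d x + perp d y"
  by (simp add: perp_def algebra_simps)

lemma perp_diff: "perp d (x - y) = perp d x - perp d y"
  by (simp add: perp_def algebra_simps)

lemma perp_self: "norm d = 1 \<Longrightarrow> perp d d = 0"
  by (simp add: perp_def dot_square_norm)

lemma perp_eq_self: "x \<bullet> d = 0 \<Longrightarrow> perp d x = x"
  by (simp add: perp_def)

lemma norm_perp_power2: "norm d = 1 \<Longrightarrow> (norm (perp d x))\<^sup>2 = (norm x)\<^sup>2 - (x \<bullet> d)\<^sup>2"
  unfolding perp_def power2_norm_eq_inner
  by (simp add: norm_eq_1 inner_diff_left inner_diff_right inner_commute power2_eq_square)

lemma norm_perp_le: "norm d = 1 \<Longrightarrow> norm (perp d x) \<le> norm x"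
  by (rule power2_le_imp_le) (simp_all add: norm_perp_power2)

lemma norm_le_perp: "norm d = 1 \<Longrightarrow> norm x \<le> norm (perp d x) + \<bar>x \<bullet> d\<bar>"
  using norm_triangle_ineq[of "perp d x" "(x \<bullet> d) *\<^sub>R d"] by (simp add: perp_def)

lemma abs_inner_le_norm: "norm d = 1 \<Longrightarrow> \<bar>x \<bullet> d\<bar> \<le> norm x"
  using Cauchy_Schwarz_ineq2[of x d] by simp

definition cyl :: "'a::real_inner \<Rightarrow> 'a \<Rightarrow> real \<Rightarrow> real \<Rightarrow> 'a set" where
  "cyl z d s h = {x. norm (perp d (x - z)) \<le> s \<and> 0 \<le> (x - z) \<bullet> d \<and> (x - z) \<bullet> d \<le> h}"

definition cyl_bdry :: "'a::real_inner \<Rightarrow> 'a \<Rightarrow> real \<Rightarrow> real \<Rightarrow> 'a set" where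
  "cyl_bdry z d s h = {x \<in> cyl z d s h. norm (perp d (x - z)) = s \<or> (x - z) \<bullet> d = 0 \<or> (x - z) \<bullet> d = h}"

definition saddle :: "real \<Rightarrow> 'a::real_inner \<Rightarrow> 'a \<Rightarrow> 'a \<Rightarrow> real" where
  "saddle \<theta> z d x = \<theta> * ((x - z) \<bullet> d)\<^sup>2 - (norm (perp d (x - z)))\<^sup>2"

text \<open>The barrier arguments use the equation for \<open>u\<close> only through this property.
  The arbitrary affine term makes it invariant under subtraction of linear functions, and the
  arbitrary coefficient \<alpha> > 0 makes it invariant under dilations.\<close>

definition saddle_comparison :: "real \<Rightarrow> 'a::real_inner set \<Rightarrow> ('a \<Rightarrow> real) \<Rightarrow> bool" where
  "saddle_comparison \<theta> D u \<longleftrightarrow>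
     (\<forall>z d s h \<alpha> c b. norm d = 1 \<and> \<alpha> > 0 \<and> cyl z d s h \<subseteq> D \<and>
        (\<forall>x\<in>cyl_bdry z d s h. c + b \<bullet> x + \<alpha> * saddle \<theta> z d x \<le> u x) \<longrightarrow>
        (\<forall>x\<in>cyl z d s h. c + b \<bullet> x + \<alpha> * saddle \<theta> z d x \<le> u x))"

lemma saddle_comparisonD:
  assumes "saddle_comparison \<theta> D u" "norm d = 1" "\<alpha> > 0" "cyl z d s h \<subseteq> D"
    and "\<And>x. x \<in> cyl_bdry z d s h \<Longrightarrow> c + k * ((x - z) \<bullet> d) + \<alpha> * saddle \<theta> z d x \<le> u x"
    and "x \<in> cyl z d s h"
  shows "c + k * ((x - z) \<bullet> d) + \<alpha> * saddle \<theta> z d x \<le> u x"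
proof -
  have eq: "(c - k * (z \<bullet> d)) + (k *\<^sub>R d) \<bullet> x = c + k * ((x - z) \<bullet> d)" for x
    by (simp add: algebra_simps inner_commute)
  show ?thesis
    using assms(1)[unfolded saddle_comparison_def, rule_format, of d \<alpha> z s h "c - k * (z \<bullet> d)" "k *\<^sub>R d" x]
      assms(2-) unfolding eq by blast
qed

lemma saddle_comparison_subset:
  "saddle_comparison \<theta> D u \<Longrightarrow> D' \<subseteq> D \<Longrightarrow> saddle_comparison \<theta> D' u"
  unfolding saddle_comparison_def by (meson subset_trans)

lemma saddle_comparison_diff_linear:
  assumes "saddle_comparison \<theta> D u"
  shows "saddle_comparison \<theta> D (\<lambda>x. u x - p \<bullet> x)"
  unfolding saddle_comparison_def
proof (intro allI impI, elim conjE)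
  fix z d :: 'a and s h \<alpha> c :: real and b :: 'a
  assume *: "norm d = 1" "\<alpha> > 0" "cyl z d s h \<subseteq> D"
    "\<forall>x\<in>cyl_bdry z d s h. c + b \<bullet> x + \<alpha> * saddle \<theta> z d x \<le> u x - p \<bullet> x"
  have "\<forall>x\<in>cyl z d s h. c + (b + p) \<bullet> x + \<alpha> * saddle \<theta> z d x \<le> u x"
    using * by (intro assms[unfolded saddle_comparison_def, rule_format, of d \<alpha> z s h c "b + p"] ballI)
      (auto simp: inner_add_left algebra_simps)
  then show "\<forall>x\<in>cyl z d s h. c + b \<bullet> x + \<alpha> * saddle \<theta> z d x \<le> u x - p \<bullet> x"
    by (auto simp: inner_add_left algebra_simps)
qed

lemma saddle_comparison_scale:
  assumes "saddle_comparison \<theta> D u" and R: "R > 0"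
  shows "saddle_comparison \<theta> {x. R *\<^sub>R x \<in> D} (\<lambda>x. u (R *\<^sub>R x))"
  unfolding saddle_comparison_def
proof (intro allI impI ballI, elim conjE)
  fix z d :: 'a and s h \<alpha> c :: real and b x :: 'a
  assume *: "norm d = 1" "\<alpha> > 0" "cyl z d s h \<subseteq> {x. R *\<^sub>R x \<in> D}"
    "\<forall>x\<in>cyl_bdry z d s h. c + b \<bullet> x + \<alpha> * saddle \<theta> z d x \<le> u (R *\<^sub>R x)"
    "x \<in> cyl z d s h"
  define T where "T y = y /\<^sub>R R" for y :: 'a
  have T: "R *\<^sub>R T y = y" for y using R by (simp add: T_def)
  have d: "R *\<^sub>R y - R *\<^sub>R z = R *\<^sub>R (y - z)" for y by (simp add: algebra_simps)
  have c: "R *\<^sub>R y \<in> cyl (R *\<^sub>R z) d (R * s) (R * h) \<longleftrightarrow> y \<in> cyl z d s h" for y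
    using R by (simp add: cyl_def d perp_scaleR zero_le_mult_iff)
  have cb: "R *\<^sub>R y \<in> cyl_bdry (R *\<^sub>R z) d (R * s) (R * h) \<longleftrightarrow> y \<in> cyl_bdry z d s h" for y
    using R c[of y] by (simp add: cyl_bdry_def d perp_scaleR)
  have sad: "saddle \<theta> (R *\<^sub>R z) d (R *\<^sub>R y) = R\<^sup>2 * saddle \<theta> z d y" for y
    by (simp only: saddle_def d perp_scaleR inner_scaleR_left norm_scaleR)
      (simp add: power_mult_distrib right_diff_distrib)
  \<comment> \<open>Dilation multiplies the saddle by \<open>R\<^sup>2\<close>, which is absorbed
    into the coefficient \<alpha>.\<close>
  have q: "c + (b /\<^sub>R R) \<bullet> (R *\<^sub>R y) + (\<alpha> / R\<^sup>2) * saddle \<theta> (R *\<^sub>R z) d (R *\<^sub>R y)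
      = c + b \<bullet> y + \<alpha> * saddle \<theta> z d y" for y
    using R by (simp add: sad)
  have "c + (b /\<^sub>R R) \<bullet> (R *\<^sub>R x) + (\<alpha> / R\<^sup>2) * saddle \<theta> (R *\<^sub>R z) d (R *\<^sub>R x) \<le> u (R *\<^sub>R x)"
  proof (rule assms(1)[unfolded saddle_comparison_def, rule_format], intro conjI ballI subsetI)
    fix y assume "y \<in> cyl (R *\<^sub>R z) d (R * s) (R * h)"
    then show "y \<in> D" using c[of "T y"] *(3) T by auto
  next
    fix y assume "y \<in> cyl_bdry (R *\<^sub>R z) d (R * s) (R * h)"
    then show "c + (b /\<^sub>R R) \<bullet> y + (\<alpha> / R\<^sup>2) * saddle \<theta> (R *\<^sub>R z) d y \<le> u y"
      using cb[of "T y"] *(4) q[of "T y"] T by auto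
  qed (use * R c in auto)
  then show "c + b \<bullet> x + \<alpha> * saddle \<theta> z d x \<le> u (R *\<^sub>R x)" unfolding q .
qed

section \<open>Propagation of lower bounds from discs and along chains of balls\<close>

text \<open>The barrier is \<open>m + k * t + \<alpha> * (\<theta> * t\<^sup>2 -
  \<xi>\<^sup>2)\<close>, with t the height over the base disc and \<xi> the distance from the axis.
  It is at most m on the base and at most 0 on the rest of the boundary, yet at least m/8 within
  half the radius and half the height.\<close>

lemma spread_from_base:
  assumes cmp: "saddle_comparison \<theta> D v" and th: "\<theta> \<ge> 1" and d: "norm d = 1" and s: "s > 0"
    and m: "m \<ge> 0" and sub: "cyl z d s (s / (2 * \<theta>)) \<subseteq> D"
    and nonneg: "\<And>x. x \<in> cyl z d s (s / (2 * \<theta>)) \<Longrightarrow> v x \<ge> 0"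
    and base: "\<And>x. x \<in> cyl z d s (s / (2 * \<theta>)) \<Longrightarrow> (x - z) \<bullet> d = 0 \<Longrightarrow> v x \<ge> m"
    and x: "norm (perp d (x - z)) \<le> s / 2" "0 \<le> (x - z) \<bullet> d" "(x - z) \<bullet> d \<le> s / (4 * \<theta>)"
  shows "v x \<ge> m / 8"
proof -
  define h where "h = s / (2 * \<theta>)"
  have h: "h > 0" and s_eq: "s = 2 * \<theta> * h" using s th by (auto simp: h_def)
  have xh: "(x - z) \<bullet> d \<le> h / 2" using x(3) th by (simp add: h_def)
  have xc: "x \<in> cyl z d s h" using x xh s h by (simp add: cyl_def)
  show ?thesis
  \<comment> \<open>The barrier coefficient is proportional to m and must be positive, so m = 0 is
    separate.\<close>
  proof (cases "m = 0")
    case True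
    then show ?thesis using nonneg[of x] xc h_def by simp
  next
    case False
    \<comment> \<open>\<alpha> is such that the loss on the lateral side equals m; k makes the
      barrier vanish where the axis meets the top.\<close>
    define \<alpha> where "\<alpha> = m / s\<^sup>2"
    define k where "k = - (m + \<alpha> * \<theta> * h\<^sup>2) / h"
    have al: "\<alpha> > 0" using False m s by (simp add: \<alpha>_def)
    have kh: "k * h = - (m + \<alpha> * \<theta> * h\<^sup>2)" using h by (simp add: k_def)
    have als: "\<alpha> * s\<^sup>2 = m" using s by (simp add: \<alpha>_def)
    \<comment> \<open>Since \<open>s = 2 * \<theta> * h\<close>, the left side equals
      \<open>m / (4 * \<theta>)\<close>.\<close>
    have small: "\<alpha> * \<theta> * h\<^sup>2 \<le> m / 4"
    proof -
      have "\<alpha> * (\<theta> * h\<^sup>2) * 4 \<le> \<alpha> * (\<theta> * h\<^sup>2) * (4 * \<theta>)"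
        using th al h by (intro mult_left_mono) auto
      also have "\<dots> = \<alpha> * s\<^sup>2" by (simp add: s_eq power2_eq_square)
      finally show ?thesis using als by simp
    qed
    have "m + k * ((x - z) \<bullet> d) + \<alpha> * saddle \<theta> z d x \<le> v x"
    proof (rule saddle_comparisonD[OF cmp d al sub[folded h_def] _ xc])
      fix y assume y: "y \<in> cyl_bdry z d s h"
      then have yc: "y \<in> cyl z d s h" by (simp add: cyl_bdry_def)
      define t where "t = (y - z) \<bullet> d"
      define \<xi> where "\<xi> = norm (perp d (y - z))"
      have t: "0 \<le> t" "t \<le> h" and xi: "0 \<le> \<xi>" "\<xi> \<le> s" using yc by (auto simp: cyl_def t_def \<xi>_def)
      have q: "\<alpha> * saddle \<theta> z d y = \<alpha> * \<theta> * t\<^sup>2 - \<alpha> * \<xi>\<^sup>2"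
        by (simp add: saddle_def t_def \<xi>_def algebra_simps)
      have "\<alpha> * \<xi>\<^sup>2 \<ge> 0" using al by simp
      from y consider "\<xi> = s" | "t = 0" | "t = h" by (auto simp: cyl_bdry_def t_def \<xi>_def)
      then show "m + k * ((y - z) \<bullet> d) + \<alpha> * saddle \<theta> z d y \<le> v y"
        unfolding t_def[symmetric] q
      proof cases
        case 1
        \<comment> \<open>By convexity in t the quadratic term lies below its chord, which the
          corresponding part of \<open>k * t\<close> cancels. The remaining m (1 - t/h) does not
          exceed the lateral loss m.\<close>
        have "\<alpha> * \<theta> * (t * t) \<le> \<alpha> * \<theta> * (h * t)"
          using t al th by (intro mult_left_mono mult_right_mono) auto
        moreover have "k * t = - (m / h * t) - \<alpha> * \<theta> * (h * t)"
          using h by (simp add: k_def field_simps power2_eq_square)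
        moreover have "m / h * t \<ge> 0" using m h t by simp
        ultimately have "m + k * t + (\<alpha> * \<theta> * t\<^sup>2 - \<alpha> * \<xi>\<^sup>2) \<le> 0"
          using als 1 by (simp add: power2_eq_square)
        then show "m + k * t + (\<alpha> * \<theta> * t\<^sup>2 - \<alpha> * \<xi>\<^sup>2) \<le> v y"
          using nonneg[of y] yc h_def by simp
      next
        case 2
        then show "m + k * t + (\<alpha> * \<theta> * t\<^sup>2 - \<alpha> * \<xi>\<^sup>2) \<le> v y"
          using base[of y] yc \<open>\<alpha> * \<xi>\<^sup>2 \<ge> 0\<close> by (simp add: t_def h_def)
      next
        case 3
        then show "m + k * t + (\<alpha> * \<theta> * t\<^sup>2 - \<alpha> * \<xi>\<^sup>2) \<le> v y"
          using nonneg[of y] yc \<open>\<alpha> * \<xi>\<^sup>2 \<ge> 0\<close> kh by (simp add: h_def)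
      qed
    qed
    moreover have "\<alpha> * (norm (perp d (x - z)))\<^sup>2 \<le> m / 4"
    proof -
      have "(norm (perp d (x - z)))\<^sup>2 \<le> (s / 2)\<^sup>2" using x(1) by (intro power_mono) auto
      then have "\<alpha> * (norm (perp d (x - z)))\<^sup>2 \<le> \<alpha> * (s / 2)\<^sup>2"
        using al by (intro mult_left_mono) auto
      then show ?thesis using als by (simp add: power_divide)
    qed
    moreover have "k * ((x - z) \<bullet> d) \<ge> - (5 * m / 8)"
    proof -
      have "k \<le> 0" using m al th h unfolding k_def by (intro divide_nonpos_pos) (auto intro!: add_nonneg_nonneg simp del: minus_add_distrib)
      then have "k * ((x - z) \<bullet> d) \<ge> k * (h / 2)" using xh by (intro mult_left_mono_neg)
      then show ?thesis using kh small by simp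
    qed
    moreover have "\<alpha> * (\<theta> * ((x - z) \<bullet> d)\<^sup>2) \<ge> 0" using al th by simp
    \<comment> \<open>At x the barrier is at least m - 5m/8 - m/4 = m/8.\<close>
    ultimately show ?thesis by (simp add: saddle_def right_diff_distrib)
  qed
qed

lemma ball_growth:
  assumes cmp: "saddle_comparison \<theta> D v" and th: "\<theta> \<ge> 1" and r: "\<rho> > 0" and m: "m \<ge> 0"
    and sub: "cball z (2 * \<rho>) \<subseteq> D" and nonneg: "\<And>x. x \<in> D \<Longrightarrow> v x \<ge> 0"
    and inner: "\<And>x. x \<in> cball z \<rho> \<Longrightarrow> v x \<ge> m"
    and x: "x \<in> cball z ((1 + 1 / (64 * \<theta>\<^sup>2)) * \<rho>)"
  shows "v x \<ge> m / 8"
proof (cases "x \<in> cball z \<rho>")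
  case True
  then show ?thesis using inner[OF True] m by simp
next
  case False
  \<comment> \<open>A disc of radius \<open>\<tau> \<rho>\<close> inscribed in the ball is within \<open>\<tau>\<^sup>2 \<rho>\<close> of the sphere, while
    \<open>spread_from_base\<close> reaches distance \<open>\<tau> \<rho> / (4 * \<theta>) = 2 * \<tau>\<^sup>2 * \<rho>\<close>.\<close>
  define \<tau> where "\<tau> = 1 / (8 * \<theta>)"
  define N where "N = norm (x - z)"
  define d where "d = (x - z) /\<^sub>R N"
  have N: "\<rho> < N" "N \<le> (1 + 1 / (64 * \<theta>\<^sup>2)) * \<rho>"
    using False x by (auto simp: N_def dist_norm norm_minus_commute)
  then have "N \<noteq> 0" using r by simp
  then have d: "norm d = 1" and xz: "x - z = N *\<^sub>R d"
    using N(1) r by (simp_all add: d_def flip: N_def)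
  have dd: "d \<bullet> d = 1" using d by (simp add: dot_square_norm)
  have tau: "0 < \<tau>" "\<tau> \<le> 1/8" using th by (auto simp: \<tau>_def field_simps)
  have tau2: "1 / (64 * \<theta>\<^sup>2) = \<tau>\<^sup>2" by (simp add: \<tau>_def power2_eq_square)
  have tau2': "\<tau>\<^sup>2 \<le> 1/64" using power_mono[of \<tau> "1/8" 2] tau by (simp add: power_divide)
  define s where "s = \<tau> * \<rho>"
  define p where "p = z + ((1 - \<tau>\<^sup>2) * \<rho>) *\<^sub>R d"
  have s: "s > 0" using tau r by (simp add: s_def)
  have ss: "s / (2 * \<theta>) = 4 * \<tau>\<^sup>2 * \<rho>" "s / (4 * \<theta>) = 2 * \<tau>\<^sup>2 * \<rho>"
    using th by (auto simp: s_def \<tau>_def power2_eq_square field_simps)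
  have xp: "x - p = (N - (1 - \<tau>\<^sup>2) * \<rho>) *\<^sub>R d"
    using xz by (simp add: p_def algebra_simps)
  have yz: "(y - z) \<bullet> d = (y - p) \<bullet> d + (1 - \<tau>\<^sup>2) * \<rho>" "perp d (y - z) = perp d (y - p)" for y
    using dd by (simp_all add: p_def algebra_simps perp_def)
  have cylsub: "y \<in> cball z (2 * \<rho>)" if "y \<in> cyl p d s (s / (2 * \<theta>))" for y
  proof -
    have "norm (y - z) \<le> norm (perp d (y - p)) + \<bar>(y - p) \<bullet> d + (1 - \<tau>\<^sup>2) * \<rho>\<bar>"
      using norm_le_perp[OF d, of "y - z"] by (simp add: yz)
    also have "\<dots> \<le> s + (4 * \<tau>\<^sup>2 * \<rho> + (1 - \<tau>\<^sup>2) * \<rho>)"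
      using that r tau2' unfolding cyl_def ss by auto
    also have "\<dots> = (1 + \<tau> + 3 * \<tau>\<^sup>2) * \<rho>" by (simp add: s_def algebra_simps)
    also have "\<dots> \<le> 2 * \<rho>" using tau tau2' r by (intro mult_right_mono) auto
    finally show ?thesis by (simp add: dist_norm norm_minus_commute)
  qed
  show ?thesis
  proof (rule spread_from_base[OF cmp th d s m])
    show "cyl p d s (s / (2 * \<theta>)) \<subseteq> D" using cylsub sub by auto
    show "v y \<ge> 0" if "y \<in> cyl p d s (s / (2 * \<theta>))" for y using cylsub[OF that] sub nonneg by auto
    show "v y \<ge> m" if y: "y \<in> cyl p d s (s / (2 * \<theta>))" "(y - p) \<bullet> d = 0" for y
    proof (rule inner)
      have "(norm (y - z))\<^sup>2 = (norm (perp d (y - p)))\<^sup>2 + ((1 - \<tau>\<^sup>2) * \<rho>)\<^sup>2"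
        using norm_perp_power2[OF d, of "y - z"] y(2) by (simp add: yz)
      also have "\<dots> \<le> s\<^sup>2 + ((1 - \<tau>\<^sup>2) * \<rho>)\<^sup>2"
        using y(1) by (auto simp: cyl_def intro!: power_mono)
      also have "\<dots> = (1 - \<tau>\<^sup>2 * (1 - \<tau>\<^sup>2)) * \<rho>\<^sup>2"
        by (simp add: s_def power2_eq_square algebra_simps)
      also have "\<dots> \<le> 1 * \<rho>\<^sup>2" using tau2' by (intro mult_right_mono) auto
      finally show "y \<in> cball z \<rho>"
        using r by (auto simp: dist_norm norm_minus_commute intro: power2_le_imp_le)
    qed
    show "norm (perp d (x - p)) \<le> s / 2" using d s unfolding xp perp_scaleR by (simp add: perp_self)
    have xpd: "(x - p) \<bullet> d = N - (1 - \<tau>\<^sup>2) * \<rho>" unfolding xp using dd by simp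
    show "0 \<le> (x - p) \<bullet> d" using N(1) r unfolding xpd by (simp add: algebra_simps)
        (smt (verit) mult_nonneg_nonneg zero_le_power2)
    show "(x - p) \<bullet> d \<le> s / (4 * \<theta>)" using N(2) unfolding xpd ss tau2 by (simp add: algebra_simps)
  qed
qed

text \<open>The segment from \<open>z0\<close> to \<open>z\<close> is cut into N pieces of length at
  most \<open>\<rho> / (64 * \<theta>\<^sup>2)\<close>. Each ball of radius \<rho> then lies in the
  enlargement of its predecessor provided by \<open>ball_growth\<close>, at the cost of a factor 8.
  Convexity keeps the doubled balls inside D.\<close>

lemma ball_chain:
  assumes cmp: "saddle_comparison \<theta> D v" and th: "\<theta> \<ge> 1" and r: "\<rho> > 0" and m: "m \<ge> 0"
    and nonneg: "\<And>x. x \<in> D \<Longrightarrow> v x \<ge> 0" and start: "\<And>x. x \<in> cball z0 \<rho> \<Longrightarrow> v x \<ge> m"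
    and D: "convex D" "cball z0 (2 * \<rho>) \<subseteq> D"
  shows "cball z (2 * \<rho>) \<subseteq> D \<Longrightarrow> norm (z - z0) \<le> real N * (\<rho> / (64 * \<theta>\<^sup>2)) \<Longrightarrow>
    x \<in> cball z \<rho> \<Longrightarrow> v x \<ge> m / 8 ^ N"
proof (induction N arbitrary: z x)
  case 0
  then show ?case using start by simp
next
  case (Suc N)
  define \<kappa> where "\<kappa> = \<rho> / (64 * \<theta>\<^sup>2)"
  \<comment> \<open>t is the parameter of \<open>w\<close>, the last division point before
    \<open>z\<close> when the segment is cut into \<open>Suc N\<close> equal pieces.\<close>
  define t where "t = real N / real (Suc N)"
  have t: "0 \<le> t" "t \<le> 1" "t * real (Suc N) = real N" "(1 - t) * real (Suc N) = 1"
    by (auto simp: t_def field_simps)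
  define w where "w = z0 + t *\<^sub>R (z - z0)"
  have wz: "z - w = (1 - t) *\<^sub>R (z - z0)" by (simp add: w_def algebra_simps)
  have le: "c * norm (z - z0) \<le> c * real (Suc N) * \<kappa>" if "c \<ge> 0" for c
    using mult_left_mono[OF Suc.prems(2) that] by (simp add: \<kappa>_def algebra_simps)
  have wsub: "cball w (2 * \<rho>) \<subseteq> D"
  proof
    fix y assume y: "y \<in> cball w (2 * \<rho>)"
    have "y = (1 - t) *\<^sub>R (z0 + (y - w)) + t *\<^sub>R (z + (y - w))"
      by (simp add: w_def algebra_simps)
    moreover have "z0 + (y - w) \<in> D" using y D(2) by (auto simp: dist_norm norm_minus_commute)
    moreover have "z + (y - w) \<in> D"
      using y Suc.prems(1) by (auto simp: dist_norm norm_minus_commute)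
    ultimately show "y \<in> D" using D(1) t by (metis convexD_alt)
  qed
  have "norm (w - z0) \<le> real N * \<kappa>" using le[of t] t by (simp add: w_def)
  then have "v y \<ge> m / 8 ^ N" if "y \<in> cball w \<rho>" for y
    using Suc.IH[OF wsub _ that] by (simp add: \<kappa>_def)
  moreover have "x \<in> cball w ((1 + 1 / (64 * \<theta>\<^sup>2)) * \<rho>)"
  proof -
    have "norm (z - w) \<le> \<kappa>" using le[of "1 - t"] t unfolding wz by simp
    moreover have "norm (x - z) \<le> \<rho>" using Suc.prems(3) by (simp add: dist_norm norm_minus_commute)
    ultimately have "norm (x - w) \<le> \<rho> + \<kappa>" using norm_triangle_ineq[of "x - z" "z - w"] by simp
    then show ?thesis by (simp add: \<kappa>_def dist_norm norm_minus_commute algebra_simps)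
  qed
  ultimately have "v x \<ge> m / 8 ^ N / 8"
    using m by (intro ball_growth[OF cmp th r _ wsub nonneg]) auto
  then show ?case by simp
qed

section \<open>The Hopf lemma in a half ball\<close>

text \<open>The barrier is \<open>k * t + \<alpha> * (\<theta> * t\<^sup>2 - \<xi>\<^sup>2)\<close>.
  The term in \<xi> makes it nonpositive on the bottom and on the side, k brings it to m at the top
  of the axis, and along the axis it dominates the linear function \<open>k * t\<close>.\<close>

lemma hopf_from_top:
  assumes cmp: "saddle_comparison \<theta> D v" and th: "\<theta> \<ge> 1" and d: "norm d = 1" and s: "s > 0"
    and m: "m \<ge> 0" and h: "h = s / (2 * \<theta>)"
    and sub: "\<And>x. norm (perp d (x - z)) \<le> s \<Longrightarrow> 0 < (x - z) \<bullet> d \<Longrightarrow> (x - z) \<bullet> d \<le> h \<Longrightarrow> x \<in> D"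
    and nonneg: "\<And>x. x \<in> D \<Longrightarrow> v x \<ge> 0"
    and top: "\<And>x. norm (perp d (x - z)) \<le> s \<Longrightarrow> (x - z) \<bullet> d = h \<Longrightarrow> v x \<ge> m"
    and t: "0 < t" "t \<le> h"
  shows "v (z + t *\<^sub>R d) \<ge> m * t / (2 * h)"
proof (cases "m = 0")
  case True
  then show ?thesis using nonneg sub t s d
    by (simp add: perp_scaleR perp_self dot_square_norm)
next
  case False
  have dd: "d \<bullet> d = 1" using d by (simp add: dot_square_norm)
  have h0: "h > 0" and s_eq: "s = 2 * \<theta> * h" using s th h by auto
  define \<alpha> where "\<alpha> = m / s\<^sup>2"
  define k where "k = (m - \<alpha> * \<theta> * h\<^sup>2) / h"
  have al: "\<alpha> > 0" using False m s by (simp add: \<alpha>_def)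
  have als: "\<alpha> * s\<^sup>2 = m" using s by (simp add: \<alpha>_def)
  have kh: "k * h = m - \<alpha> * \<theta> * h\<^sup>2" using h0 by (simp add: k_def)
  \<comment> \<open>The choice of h makes the left side \<open>m / (4 * \<theta>)\<close>, so at
    least half of m is left to the linear term at the top.\<close>
  have small: "\<alpha> * \<theta> * h\<^sup>2 \<le> m / 2"
  proof -
    have "\<alpha> * (\<theta> * h\<^sup>2) * 2 \<le> \<alpha> * (\<theta> * h\<^sup>2) * (4 * \<theta>)"
      using th al h0 by (intro mult_left_mono) auto
    also have "\<dots> = \<alpha> * s\<^sup>2" by (simp add: s_eq power2_eq_square)
    finally show ?thesis using als by simp
  qed
  have k: "k \<ge> m / (2 * h)" using small h0 by (simp add: k_def field_simps)
  then have k0: "k \<ge> 0" using m h0 by (smt (verit) divide_nonneg_pos)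
  \<comment> \<open>The bottom disc need not lie in \<open>D\<close>, so the barrier is placed at height \<open>\<tau>\<close> above it.\<close>
  have shifted: "k * (t - \<tau>) \<le> v (z + t *\<^sub>R d)" if tau: "0 < \<tau>" "\<tau> < t" for \<tau>
  proof -
    define z' where "z' = z + \<tau> *\<^sub>R d"
    have z': "(y - z) \<bullet> d = (y - z') \<bullet> d + \<tau>" "perp d (y - z) = perp d (y - z')" for y
      using dd by (simp_all add: z'_def algebra_simps perp_def)
    have cD: "y \<in> D" if "y \<in> cyl z' d s (h - \<tau>)" for y
      using that tau by (intro sub) (auto simp: cyl_def z')
    have "0 + k * ((z + t *\<^sub>R d - z') \<bullet> d) + \<alpha> * saddle \<theta> z' d (z + t *\<^sub>R d) \<le> v (z + t *\<^sub>R d)"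
    proof (rule saddle_comparisonD[OF cmp d al])
      show "cyl z' d s (h - \<tau>) \<subseteq> D" using cD by auto
      have "z + t *\<^sub>R d - z' = (t - \<tau>) *\<^sub>R d" by (simp add: z'_def algebra_simps)
      then show "z + t *\<^sub>R d \<in> cyl z' d s (h - \<tau>)"
        using t tau s d dd by (simp add: cyl_def perp_scaleR perp_self)
      fix y assume y: "y \<in> cyl_bdry z' d s (h - \<tau>)"
      then have yc: "y \<in> cyl z' d s (h - \<tau>)" by (simp add: cyl_bdry_def)
      define t' where "t' = (y - z') \<bullet> d"
      define \<xi> where "\<xi> = norm (perp d (y - z'))"
      have t': "0 \<le> t'" "t' \<le> h" and xi: "0 \<le> \<xi>" "\<xi> \<le> s"
        using yc tau by (auto simp: cyl_def t'_def \<xi>_def)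
      have q: "\<alpha> * saddle \<theta> z' d y = \<alpha> * \<theta> * t'\<^sup>2 - \<alpha> * \<xi>\<^sup>2"
        by (simp add: saddle_def t'_def \<xi>_def algebra_simps)
      have xi0: "\<alpha> * \<xi>\<^sup>2 \<ge> 0" using al by simp
      have "\<alpha> * \<theta> * t'\<^sup>2 \<le> \<alpha> * \<theta> * h\<^sup>2" using t' al th by (intro mult_left_mono power_mono) auto
      moreover have "k * t' \<le> k * h" using k0 t' by (intro mult_left_mono)
      ultimately have le: "k * t' + \<alpha> * \<theta> * t'\<^sup>2 \<le> m" using kh by simp
      from y consider "\<xi> = s" | "t' = 0" | "t' = h - \<tau>" by (auto simp: cyl_bdry_def t'_def \<xi>_def)
      then show "0 + k * ((y - z') \<bullet> d) + \<alpha> * saddle \<theta> z' d y \<le> v y"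
        unfolding t'_def[symmetric] q
      proof cases
        case 1
        then show "0 + k * t' + (\<alpha> * \<theta> * t'\<^sup>2 - \<alpha> * \<xi>\<^sup>2) \<le> v y"
          using le als nonneg[OF cD[OF yc]] by simp
      next
        case 2
        then show "0 + k * t' + (\<alpha> * \<theta> * t'\<^sup>2 - \<alpha> * \<xi>\<^sup>2) \<le> v y"
          using xi0 nonneg[OF cD[OF yc]] by simp
      next
        case 3
        then have "v y \<ge> m" using yc by (intro top) (auto simp: z' t'_def cyl_def)
        then show "0 + k * t' + (\<alpha> * \<theta> * t'\<^sup>2 - \<alpha> * \<xi>\<^sup>2) \<le> v y"
          using xi0 le by simp
      qed
    qed
    moreover have "z + t *\<^sub>R d - z' = (t - \<tau>) *\<^sub>R d" by (simp add: z'_def algebra_simps)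
    moreover have "\<alpha> * (\<theta> * (t - \<tau>)\<^sup>2) \<ge> 0" using al th by simp
    ultimately show ?thesis using d dd by (simp add: saddle_def perp_scaleR perp_self)
  qed
  \<comment> \<open>Letting \<tau> tend to 0 moves the barrier back to the original base.\<close>
  have "k * t \<le> v (z + t *\<^sub>R d)"
  proof (rule tendsto_upperbound)
    show "((\<lambda>\<tau>. k * (t - \<tau>)) \<longlongrightarrow> k * t) (at_right 0)" by (auto intro!: tendsto_eq_intros)
    show "\<forall>\<^sub>F \<tau> in at_right 0. k * (t - \<tau>) \<le> v (z + t *\<^sub>R d)"
      using shifted t by (auto simp: eventually_at_right_field)
  qed simp
  moreover have "m / (2 * h) * t \<le> k * t" using k t by (intro mult_right_mono) auto
  ultimately show ?thesis by simp
qed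

definition half_ball :: "'a::real_inner \<Rightarrow> 'a set" where
  "half_ball e = {x \<in> ball 0 1. x \<bullet> e > 0}"

lemma convex_half_ball: "convex (half_ball e)"
proof -
  have "half_ball e = ball 0 1 \<inter> {x. e \<bullet> x > 0}" by (auto simp: half_ball_def inner_commute)
  then show ?thesis by (simp add: convex_Int convex_halfspace_gt)
qed

lemma cball_subset_half_ball:
  assumes "norm e = 1" "z \<bullet> e > r" "norm z + r < 1"
  shows "cball z r \<subseteq> half_ball e"
proof
  fix x assume "x \<in> cball z r"
  then have x: "norm (x - z) \<le> r" by (simp add: dist_norm norm_minus_commute)
  then have "norm x \<le> norm z + r" using norm_triangle_ineq[of z "x - z"] by simp
  moreover have "x \<bullet> e \<ge> z \<bullet> e - r"
    using abs_inner_le_norm[OF assms(1), of "x - z"] x by (simp add: inner_diff_left)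
  ultimately show "x \<in> half_ball e" using assms by (simp add: half_ball_def)
qed

text \<open>\<open>ball_chain\<close> carries the bound from the ball about z to all points at
  height \<open>1 / (8 * \<theta>)\<close> over a disc around the foot of x, and
  \<open>hopf_from_top\<close> turns it into linear growth down to x. The number of links depends
  only on \<theta> and \<rho>, so c is uniform in v, e, z and m.\<close>

lemma hopf_from_ball:
  fixes \<theta> \<rho> :: real
  assumes th: "\<theta> \<ge> 1" and r: "\<rho> > 0" "\<rho> < 1 / (16 * \<theta>)"
  obtains c where "c > 0"
    and "\<And>(v :: 'a::real_inner \<Rightarrow> real) e z m x.
      saddle_comparison \<theta> (half_ball e) v \<Longrightarrow> norm e = 1 \<Longrightarrow> (\<And>x. x \<in> half_ball e \<Longrightarrow> v x \<ge> 0) \<Longrightarrow>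
      m \<ge> 0 \<Longrightarrow> cball z (2 * \<rho>) \<subseteq> half_ball e \<Longrightarrow> (\<And>x. x \<in> cball z \<rho> \<Longrightarrow> v x \<ge> m) \<Longrightarrow>
      norm x < 1 / (8 * \<theta>) \<Longrightarrow> x \<bullet> e > 0 \<Longrightarrow> v x \<ge> c * m * (x \<bullet> e)"
proof
  \<comment> \<open>Points of the unit ball are less than 2 apart, so N links always
    suffice.\<close>
  define N where "N = nat \<lceil>2 / (\<rho> / (64 * \<theta>\<^sup>2))\<rceil>"
  have kap: "\<rho> / (64 * \<theta>\<^sup>2) > 0" using th r by simp
  have "2 / (\<rho> / (64 * \<theta>\<^sup>2)) \<le> real N" unfolding N_def by linarith
  then have N: "2 \<le> real N * (\<rho> / (64 * \<theta>\<^sup>2))" using pos_divide_le_eq[OF kap] by blast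
  define h where "h = 1 / (8 * \<theta>)"
  have h: "h > 0" "h \<le> 1/8" using th by (auto simp: h_def field_simps)
  define c where "c = 1 / (8 ^ N * (2 * h))"
  show "c > 0" using h by (simp add: c_def)
  fix v :: "'a \<Rightarrow> real" and e z x :: 'a and m :: real
  assume cmp: "saddle_comparison \<theta> (half_ball e) v" and e: "norm e = 1"
    and nonneg: "\<And>x. x \<in> half_ball e \<Longrightarrow> v x \<ge> 0"
    and m: "m \<ge> 0" and sub: "cball z (2 * \<rho>) \<subseteq> half_ball e" and start: "\<And>x. x \<in> cball z \<rho> \<Longrightarrow> v x \<ge> m"
    and x: "norm x < 1 / (8 * \<theta>)" "x \<bullet> e > 0"
  \<comment> \<open>Doubled balls centred at height h therefore stay above the flat
    boundary.\<close>
  have r2: "2 * \<rho> < h" using r by (simp add: h_def)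
  have ee: "e \<bullet> e = 1" using e by (simp add: dot_square_norm)
  define p where "p = perp e x"
  have p: "norm p < h" using norm_perp_le[OF e, of x] x by (simp add: p_def h_def)
  have pe: "p \<bullet> e = 0" using ee by (simp add: p_def perp_def algebra_simps)
  have norm_y: "norm y \<le> 1/2" if "norm (perp e (y - p)) \<le> 1/4" "0 < (y - p) \<bullet> e" "(y - p) \<bullet> e \<le> h" for y
  proof -
    have "norm y \<le> norm p + norm (y - p)" using norm_triangle_ineq[of p "y - p"] by simp
    also have "norm (y - p) \<le> 1/4 + h" using norm_le_perp[OF e, of "y - p"] that by linarith
    finally show ?thesis using p h by simp
  qed
  \<comment> \<open>The cylinder stands on the foot p of x; radius 1/4 makes its height
    \<open>s / (2 * \<theta>)\<close> equal to h.\<close>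
  have "v (p + (x \<bullet> e) *\<^sub>R e) \<ge> (m / 8 ^ N) * (x \<bullet> e) / (2 * h)"
  proof (rule hopf_from_top[OF cmp th e, where s = "1/4"])
    show "h = 1 / 4 / (2 * \<theta>)" by (simp add: h_def)
    show "0 \<le> m / 8 ^ N" using m by simp
    show "x \<bullet> e \<le> h" using abs_inner_le_norm[OF e, of x] x by (simp add: h_def)
  next
    fix y assume y: "norm (perp e (y - p)) \<le> 1/4" "0 < (y - p) \<bullet> e" "(y - p) \<bullet> e \<le> h"
    then show "y \<in> half_ball e" using norm_y[OF y] pe by (simp add: half_ball_def inner_diff_left)
  next
    fix y assume y: "norm (perp e (y - p)) \<le> 1/4" "(y - p) \<bullet> e = h"
    have ny: "norm y \<le> 1/2" using norm_y y h by simp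
    have "cball y (2 * \<rho>) \<subseteq> half_ball e"
      using y pe ny r2 h by (intro cball_subset_half_ball[OF e]) (auto simp: inner_diff_left)
    moreover have "norm (y - z) \<le> real N * (\<rho> / (64 * \<theta>\<^sup>2))"
    proof -
      have "z \<in> half_ball e" using sub r by auto
      then have "norm z < 1" by (simp add: half_ball_def)
      then show ?thesis using ny N norm_triangle_ineq4[of y z] by linarith
    qed
    ultimately show "v y \<ge> m / 8 ^ N"
      using ball_chain[OF cmp th r(1) m nonneg start convex_half_ball sub, of y N y] r by simp
  qed (use nonneg x in auto)
  then show "v x \<ge> c * m * (x \<bullet> e)" by (simp add: p_def perp_def c_def)
qed

section \<open>Weak derivatives of classical functions and essential lower limits\<close>

text \<open>By translation invariance the difference quotients of \<open>F\<close> have integral zero.\<close>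

lemma integral_directional_derivative_eq_0:
  fixes F :: "'a::euclidean_space \<Rightarrow> real"
  assumes F: "\<And>x. (F has_derivative F' x) (at x)" and G: "continuous_on UNIV (\<lambda>x. F' x v)"
    and K: "compact K" and zero: "\<And>x. x \<notin> K \<Longrightarrow> F x = 0"
  shows "(\<integral>x. F' x v \<partial>lborel) = 0"
proof -
  have contF: "continuous_on UNIV F"
    using F by (metis continuous_at_imp_continuous_on has_derivative_continuous)
  have zeroG: "F' x v = 0" if "x \<notin> K" for x
  proof -
    have "(F has_derivative (\<lambda>_. 0)) (at x)"
      by (rule has_derivative_transform_within_open[OF has_derivative_const, of "- K" x 0])
        (use K zero that in \<open>auto simp: compact_imp_closed open_Compl\<close>)
    then show ?thesis using F has_derivative_unique by metis
  qed
  obtain r where r: "K \<subseteq> cball 0 r"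
    using compact_imp_bounded[OF K] by (auto simp: bounded_iff subset_iff)
  obtain B where B: "B \<ge> 0" "\<And>x. \<bar>F' x v\<bar> \<le> B"
  proof -
    have "bounded ((\<lambda>x. F' x v) ` K)"
      using K G by (intro compact_imp_bounded compact_continuous_image) (auto intro: continuous_on_subset)
    then obtain B where "\<And>x. x \<in> K \<Longrightarrow> \<bar>F' x v\<bar> \<le> B" by (auto simp: bounded_iff)
    then have "\<bar>F' x v\<bar> \<le> max B 0" for x
      by (cases "x \<in> K") (auto simp: zeroG intro: max.coboundedI1)
    then show ?thesis using that[of "max B 0"] by auto
  qed
  have line: "((\<lambda>s. F (x + s *\<^sub>R v)) has_derivative (\<lambda>h. h * F' (x + s *\<^sub>R v) v)) (at s)" for x s
  proof -
    have "((\<lambda>s. F (x + s *\<^sub>R v)) has_derivative (\<lambda>h. F' (x + s *\<^sub>R v) (h *\<^sub>R v))) (at s)"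
      by (rule has_derivative_compose[OF _ F, of "\<lambda>s. x + s *\<^sub>R v" "\<lambda>h. h *\<^sub>R v"])
        (auto intro!: derivative_eq_intros)
    then show ?thesis using linear_scale[OF has_derivative_linear[OF F]] by simp
  qed
  define t where "t n = 1 / real (Suc n)" for n
  have t: "0 < t n" "t n \<le> 1" for n by (auto simp: t_def field_simps)
  have tlim: "t \<longlonglongrightarrow> 0" unfolding t_def using LIMSEQ_inverse_real_of_nat by (simp add: inverse_eq_divide)
  define q where "q n x = (F (x + t n *\<^sub>R v) - F x) / t n" for n x
  have intF: "integrable lborel F"
  proof -
    have "integrable lborel (\<lambda>x. indicator K x *\<^sub>R F x)"
      using K contF by (intro borel_integrable_compact) (auto intro: continuous_on_subset)
    moreover have "(\<lambda>x. indicator K x *\<^sub>R F x) = F" using zero by (intro ext) (auto simp: indicator_def)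
    ultimately show ?thesis by simp
  qed
  have bF: "F \<in> borel_measurable borel" using contF by (rule borel_measurable_continuous_onI)
  have int_shift: "integrable lborel (\<lambda>x. F (x + w))" "(\<integral>x. F (x + w) \<partial>lborel) = (\<integral>x. F x \<partial>lborel)" for w
  proof -
    have "integrable (distr lborel borel ((+) w)) F" using intF by (simp add: lborel_distr_plus)
    then show "integrable lborel (\<lambda>x. F (x + w))" using bF by (simp add: integrable_distr_eq add.commute)
    have "(\<integral>x. F x \<partial>lborel) = (\<integral>x. F x \<partial>distr lborel borel ((+) w))" by (simp add: lborel_distr_plus)
    also have "\<dots> = (\<integral>x. F (x + w) \<partial>lborel)" using bF by (simp add: integral_distr add.commute)
    finally show "(\<integral>x. F (x + w) \<partial>lborel) = (\<integral>x. F x \<partial>lborel)" by simp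
  qed
  have int_q: "(\<integral>x. q n x \<partial>lborel) = 0" for n
    using int_shift intF by (simp add: q_def)
  have lim: "(\<lambda>n. q n x) \<longlonglongrightarrow> F' x v" for x
  proof -
    have "((\<lambda>s. F (x + s *\<^sub>R v)) has_real_derivative F' x v) (at 0)"
      using line[of x 0] by (simp add: has_field_derivative_def mult.commute[of _ "F' x v"])
    then have "((\<lambda>s. (F (x + s *\<^sub>R v) - F x) / s) \<longlongrightarrow> F' x v) (at 0)" by (simp add: DERIV_def)
    moreover have "filterlim t (at 0) sequentially"
      using tlim t by (simp add: filterlim_at less_imp_neq[symmetric])
    ultimately show ?thesis unfolding q_def by (rule filterlim_compose)
  qed
  \<comment> \<open>The dominating function comes from the mean value theorem; since
    \<open>t n\<close> is at most 1, the quotient vanishes outside the enlarged ball.\<close>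
  have bound: "\<bar>q n x\<bar> \<le> indicator (cball 0 (r + norm v)) x *\<^sub>R B" for n x
  proof (cases "x \<in> cball 0 (r + norm v)")
    case True
    have "\<exists>s\<in>{0<..<t n}. F (x + t n *\<^sub>R v) - F (x + 0 *\<^sub>R v) = (t n - 0) * F' (x + s *\<^sub>R v) v"
      by (rule mvt[OF t(1)[of n], of "\<lambda>s. F (x + s *\<^sub>R v)" "\<lambda>s h. h * F' (x + s *\<^sub>R v) v"])
        (auto intro!: continuous_on_compose2[OF contF] continuous_intros line)
    then obtain s where "F (x + t n *\<^sub>R v) - F x = t n * F' (x + s *\<^sub>R v) v" by auto
    then have "q n x = F' (x + s *\<^sub>R v) v" using t(1)[of n] by (simp add: q_def)
    then show ?thesis using B True by simp
  next
    case False
    then have nx: "norm x > r + norm v" by simp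
    have "norm (x + t n *\<^sub>R v) \<ge> norm x - norm (t n *\<^sub>R v)" using norm_diff_ineq by blast
    moreover have "norm (t n *\<^sub>R v) \<le> norm v" using t[of n] by (simp add: mult_left_le_one_le)
    ultimately have "norm (x + t n *\<^sub>R v) > r" using nx by simp
    moreover have "norm x > r" using nx norm_ge_zero[of v] by linarith
    ultimately have "x + t n *\<^sub>R v \<notin> K" "x \<notin> K" using r by auto
    then show ?thesis using zero B by (simp add: q_def)
  qed
  have "(\<lambda>n. \<integral>x. q n x \<partial>lborel) \<longlonglongrightarrow> (\<integral>x. F' x v \<partial>lborel)"
  proof (rule integral_dominated_convergence)
    show "(\<lambda>x. F' x v) \<in> borel_measurable lborel" using borel_measurable_continuous_onI[OF G] by simp
    show "q n \<in> borel_measurable lborel" for n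
      using int_shift(1)[THEN borel_measurable_integrable] bF unfolding q_def by measurable
    show "integrable lborel (\<lambda>x. indicator (cball 0 (r + norm v)) x *\<^sub>R B)"
      by (intro borel_integrable_compact) auto
  qed (use lim bound in auto)
  then show ?thesis by (simp add: int_q LIMSEQ_const_iff)
qed

text \<open>The derivative of \<open>f * \<psi>\<close> along the i-th axis is the sum of the two
  integrands, and its integral vanishes by
  \<open>integral_directional_derivative_eq_0\<close>.\<close>

lemma weak_partial_classical:
  fixes f :: "real^'n \<Rightarrow> real"
  assumes D: "open D" and f: "\<And>x. (f has_derivative f' x) (at x)"
    and cont: "continuous_on UNIV (\<lambda>x. f' x (axis i 1))"
  shows "weak_partial D i f (\<lambda>x. f' x (axis i 1))"
  unfolding weak_partial_def
proof (intro allI impI)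
  fix \<psi> :: "real^'n \<Rightarrow> real" assume "test_function D \<psi>"
  then have ck: "Ck_function 1 \<psi>" and K: "compact (closure (support_on UNIV \<psi>))"
    and KD: "closure (support_on UNIV \<psi>) \<subseteq> D" unfolding test_function_def by blast+
  define K where "K = closure (support_on UNIV \<psi>)"
  define v :: "real^'n" where "v = axis i 1"
  have diff: "(\<psi> has_derivative frechet_derivative \<psi> (at x)) (at x)" for x
    using ck by (simp add: frechet_derivative_works[symmetric])
  have cont_d: "continuous_on UNIV (\<lambda>x. frechet_derivative \<psi> (at x) v)"
    using ck by (simp add: partial_deriv_def[abs_def] v_def)
  have zero: "\<psi> x = 0" if "x \<notin> K" for x
    using that closure_subset[of "support_on UNIV \<psi>"] by (auto simp: K_def support_on_def)
  have zero_d: "frechet_derivative \<psi> (at x) v = 0" if "x \<notin> K" for x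
  proof -
    have "(\<psi> has_derivative (\<lambda>_. 0)) (at x)"
      by (rule has_derivative_transform_within_open[OF has_derivative_const, of "- K" x 0])
        (use zero that in \<open>auto simp: K_def open_Compl\<close>)
    then show ?thesis using diff has_derivative_unique by metis
  qed
  have contf: "continuous_on UNIV f" "continuous_on UNIV \<psi>"
    using f diff by (metis continuous_at_imp_continuous_on has_derivative_continuous)+
  \<comment> \<open>A continuous function vanishing off the compact set \<open>K\<close>, which lies
    in D, has the same integral over D as over the whole space; this passes from
    \<open>lebesgue_on\<close> to \<open>lborel\<close>.\<close>
  have intK: "integrable lborel g" "LINT x|lebesgue_on D. g x = LINT x|lborel. g x"
    if g: "continuous_on UNIV g" "\<And>x. x \<notin> K \<Longrightarrow> g x = 0" for g :: "real^'n \<Rightarrow> real"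
  proof -
    have "integrable lborel (\<lambda>x. indicator K x *\<^sub>R g x)"
      using K g by (intro borel_integrable_compact) (auto simp: K_def intro: continuous_on_subset)
    moreover have "(\<lambda>x. indicator K x *\<^sub>R g x) = g" using g(2) by (intro ext) (auto simp: indicator_def)
    ultimately show "integrable lborel g" by simp
    have "(LINT x|lebesgue_on D. g x) = (LINT x|lebesgue. indicator D x *\<^sub>R g x)"
      using D by (intro integral_restrict_space) auto
    also have "(\<lambda>x. indicator D x *\<^sub>R g x) = g"
      using g(2) KD by (intro ext) (auto simp: indicator_def K_def)
    also have "(LINT x|lebesgue. g x) = (LINT x|lborel. g x)"
      using borel_measurable_continuous_onI[OF g(1)] by (intro integral_completion) simp
    finally show "LINT x|lebesgue_on D. g x = LINT x|lborel. g x" .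
  qed
  define A where "A x = f x * frechet_derivative \<psi> (at x) v" for x
  define B where "B x = f' x v * \<psi> x" for x
  have A: "continuous_on UNIV A" "\<And>x. x \<notin> K \<Longrightarrow> A x = 0"
    using contf cont_d zero_d by (auto simp: A_def intro!: continuous_intros)
  have B: "continuous_on UNIV B" "\<And>x. x \<notin> K \<Longrightarrow> B x = 0"
    using contf cont zero by (auto simp: B_def v_def intro!: continuous_intros)
  have "(LINT x|lborel. f x * frechet_derivative \<psi> (at x) v + f' x v * \<psi> x) = 0"
  proof (rule integral_directional_derivative_eq_0[where F = "\<lambda>x. f x * \<psi> x" and K = K])
    show "((\<lambda>x. f x * \<psi> x) has_derivative (\<lambda>h. f x * frechet_derivative \<psi> (at x) h + f' x h * \<psi> x)) (at x)" for x
      using has_derivative_mult[OF f diff] .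
    show "continuous_on UNIV (\<lambda>x. f x * frechet_derivative \<psi> (at x) v + f' x v * \<psi> x)"
      using continuous_on_add[OF A(1) B(1)] by (simp add: A_def B_def)
  qed (use K zero in \<open>auto simp: K_def\<close>)
  then have "(LINT x|lborel. A x) + (LINT x|lborel. B x) = 0"
    using intK(1)[OF A] intK(1)[OF B] by (simp add: A_def B_def)
  then show "(LINT x|lebesgue_on D. f x * partial_deriv i \<psi> x) =
      - (LINT x|lebesgue_on D. f' x (axis i 1) * \<psi> x)"
    using intK(2)[OF A] intK(2)[OF B] by (simp add: A_def B_def partial_deriv_def v_def)
qed

lemma in_Lp_continuous:
  fixes f :: "real^'n \<Rightarrow> real"
  assumes "open D" "bounded D" and f: "continuous_on UNIV f"
  shows "in_Lp p D f"
proof -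
  obtain r where r: "D \<subseteq> cball 0 r" using assms(2) by (auto simp: bounded_iff subset_iff)
  have D: "D \<in> sets lebesgue" using assms(1) by auto
  have "integrable lborel (\<lambda>x. indicator (cball 0 r) x *\<^sub>R \<bar>f x\<bar> ^ p)"
    using f by (intro borel_integrable_compact) (auto intro!: continuous_intros intro: continuous_on_subset)
  then have "integrable lebesgue (\<lambda>x. indicator (cball 0 r) x *\<^sub>R \<bar>f x\<bar> ^ p)"
    by (simp add: integrable_completion borel_measurable_integrable)
  from integrable_mult_indicator[OF D this]
  have "integrable lebesgue (\<lambda>x. indicator D x *\<^sub>R \<bar>f x\<bar> ^ p)"
    by (rule back_subst[where P = "integrable lebesgue"]) (use r in \<open>intro ext, auto simp: indicator_def subset_iff\<close>)
  then have "integrable (lebesgue_on D) (\<lambda>x. \<bar>f x\<bar> ^ p)"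
    using D by (subst integrable_restrict_space) auto
  moreover have "f \<in> borel_measurable (lebesgue_on D)"
    using D f by (intro continuous_imp_measurable_on_sets_lebesgue) (auto intro: continuous_on_subset)
  ultimately show ?thesis by (simp add: in_Lp_def)
qed

text \<open>The filter is proper because a nonempty open set is not a null set.\<close>

lemma ess_liminf_at_const: "ess_liminf_at x (\<lambda>_. c) = ereal c"
  unfolding ess_liminf_at_def
proof (rule Liminf_const)
  show "inf (nhds x) (ae_filter lebesgue) \<noteq> bot"
  proof
    assume "inf (nhds x) (ae_filter lebesgue) = bot"
    then have "\<forall>\<^sub>F _ in inf (nhds x) (ae_filter lebesgue). False" by simp
    then obtain P Q where P: "eventually P (nhds x)" and Q: "AE y in lebesgue. Q y"
      and PQ: "\<And>y. \<not> (P y \<and> Q y)" unfolding eventually_inf by blast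
    obtain S where S: "open S" "x \<in> S" "\<And>y. y \<in> S \<Longrightarrow> P y"
      using P unfolding eventually_nhds by blast
    have "AE y in lebesgue. y \<notin> S" using Q by eventually_elim (use S PQ in blast)
    then have "S \<in> null_sets lebesgue" using S(1) by (subst (asm) AE_iff_null_sets[symmetric]) auto
    then show False using S open_not_negligible[of S] by (auto simp: negligible_iff_null_sets)
  qed
qed

section \<open>Saddles as test functions for the Pucci operator\<close>

text \<open>This is a I + (b - a) d d^T. For a unit vector d it has eigenvalue b on the line of d
  and a on the orthogonal complement.\<close>

definition axial :: "real \<Rightarrow> real \<Rightarrow> real^'n \<Rightarrow> real^'n^'n" where
  "axial a b d = (\<chi> i j. (if i = j then a else 0) + (b - a) * d $ i * d $ j)"

lemma axial_mult: "axial a b d *v v = a *\<^sub>R v + ((b - a) * (d \<bullet> v)) *\<^sub>R d"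
proof -
  have "(\<Sum>j\<in>UNIV. ((if i = j then a else 0) + (b - a) * d $ i * d $ j) * v $ j)
      = a * v $ i + (b - a) * (\<Sum>j\<in>UNIV. d $ j * v $ j) * d $ i" for i
  proof -
    have "(\<Sum>j\<in>UNIV. ((if i = j then a else 0) + (b - a) * d $ i * d $ j) * v $ j)
        = (\<Sum>j\<in>UNIV. (if i = j then a * v $ j else 0)) + (\<Sum>j\<in>UNIV. (b - a) * d $ i * (d $ j * v $ j))"
      unfolding sum.distrib[symmetric] by (intro sum.cong) (auto simp: algebra_simps)
    then show ?thesis by (simp add: sum_distrib_left[symmetric])
  qed
  then show ?thesis
    by (simp add: vec_eq_iff matrix_vector_mult_def axial_def inner_vec_def)
qed

lemma pucci_min_axial:
  fixes d :: "real^'n"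
  assumes d: "norm d = 1" and n: "CARD('n) \<ge> 2" and a: "a < 0" and b: "b > 0"
  shows "pucci_min lam Lam (axial a b d) = lam * b + Lam * (real (CARD('n) - 1) * a)"
proof -
  have dd: "d \<bullet> d = 1" using d by (simp add: dot_square_norm)
  have Ea: "eigenspace (axial a b d) a = {v. d \<bullet> v = 0}"
    using a b d by (auto simp: eigenspace_def axial_mult)
  have Eb: "eigenspace (axial a b d) b = span {d}"
  proof -
    have "axial a b d *v v = b *\<^sub>R v \<longleftrightarrow> v = (d \<bullet> v) *\<^sub>R d" for v
    proof -
      have "axial a b d *v v = b *\<^sub>R v \<longleftrightarrow> (b - a) *\<^sub>R v = (b - a) *\<^sub>R ((d \<bullet> v) *\<^sub>R d)"
        by (auto simp: axial_mult algebra_simps)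
      also have "\<dots> \<longleftrightarrow> v = (d \<bullet> v) *\<^sub>R d" using a b by (simp only: scaleR_cancel_left) simp
      finally show ?thesis .
    qed
    moreover have "v = (d \<bullet> v) *\<^sub>R d \<longleftrightarrow> v \<in> span {d}" for v
      using dd by (auto simp: span_singleton)
    ultimately show ?thesis by (auto simp: eigenspace_def)
  qed
  have dim_a: "dim {v. d \<bullet> v = 0} = CARD('n) - 1"
    using dim_hyperplane[of d] d by force
  have ev: "eigenvalues (axial a b d) = {a, b}"
  proof (intro equalityI subsetI)
    fix \<mu> assume "\<mu> \<in> eigenvalues (axial a b d)"
    then obtain v where v: "v \<noteq> 0" "a *\<^sub>R v + ((b - a) * (d \<bullet> v)) *\<^sub>R d = \<mu> *\<^sub>R v"
      by (auto simp: eigenvalues_def eigenspace_def axial_mult)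
    have "d \<bullet> (a *\<^sub>R v + ((b - a) * (d \<bullet> v)) *\<^sub>R d) = d \<bullet> (\<mu> *\<^sub>R v)" using v by simp
    then have "b * (d \<bullet> v) = \<mu> * (d \<bullet> v)" using dd by (simp add: inner_add_right algebra_simps)
    then have "\<mu> = b \<or> d \<bullet> v = 0" by auto
    then show "\<mu> \<in> {a, b}" using v by auto
  next
    fix \<mu> assume "\<mu> \<in> {a, b}"
    \<comment> \<open>In dimension at least 2 there is a nonzero vector orthogonal to d, so a does
      occur as an eigenvalue.\<close>
    moreover have "a \<in> eigenvalues (axial a b d)"
    proof -
      obtain v where "v \<noteq> 0" "orthogonal d v"
        using orthogonal_to_vector_exists[of d] n by auto
      then have "v \<noteq> 0" "v \<in> eigenspace (axial a b d) a" by (auto simp: Ea orthogonal_def)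
      then show ?thesis unfolding eigenvalues_def by blast
    qed
    moreover have "b \<in> eigenvalues (axial a b d)"
    proof -
      have "d \<in> span {d}" "d \<noteq> 0" using d by (auto simp: span_base)
      then show ?thesis unfolding eigenvalues_def Eb[symmetric] by blast
    qed
    ultimately show "\<mu> \<in> eigenvalues (axial a b d)" by auto
  qed
  have "{\<mu> \<in> {a, b}. \<mu> > 0} = {b}" "{\<mu> \<in> {a, b}. \<mu> < 0} = {a}" using a b by auto
  moreover have "dim (span {d}) = 1" using d by (subst dim_span, subst dim_singleton) auto
  ultimately show ?thesis by (simp add: pucci_min_def ev Ea Eb dim_a)
qed

lemma saddle_eq:
  assumes "norm d = 1"
  shows "saddle \<theta> z d x = (\<theta> + 1) * ((x - z) \<bullet> d)\<^sup>2 - (x - z) \<bullet> (x - z)"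
  unfolding saddle_def norm_perp_power2[OF assms] by (simp add: power2_norm_eq_inner distrib_right)

lemma saddle_has_derivative:
  assumes "norm d = 1"
  shows "((\<lambda>x. c + b \<bullet> x + \<alpha> * saddle \<theta> z d x) has_derivative
    (\<lambda>h. (b + (2 * \<alpha>) *\<^sub>R (((\<theta> + 1) * ((x - z) \<bullet> d)) *\<^sub>R d - (x - z))) \<bullet> h)) (at x)"
  unfolding saddle_eq[OF assms]
  by (auto intro!: derivative_eq_intros simp: inner_commute algebra_simps power2_eq_square)

text \<open>The function is a quadratic polynomial, so its weak derivatives are the classical ones
  and its Hessian is constant; boundedness of D gives integrability.\<close>

lemma W2p_saddle:
  fixes d :: "real^'n"
  assumes D: "open D" "bounded D" and d: "norm d = 1"
  shows "W2p_with_hessian p D (\<lambda>x. c + b \<bullet> x + \<alpha> * saddle \<theta> z d x)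
    (\<lambda>_. axial (- 2 * \<alpha>) (2 * \<alpha> * \<theta>) d)"
proof -
  define G where "G x = b + (2 * \<alpha>) *\<^sub>R (((\<theta> + 1) * ((x - z) \<bullet> d)) *\<^sub>R d - (x - z))" for x
  define H where "H = axial (- 2 * \<alpha>) (2 * \<alpha> * \<theta>) d"
  have contG: "continuous_on UNIV (\<lambda>x. G x $ i)" for i
    unfolding G_def by (intro continuous_intros)
  have "continuous_on UNIV (\<lambda>x. c + b \<bullet> x + \<alpha> * saddle \<theta> z d x)"
    unfolding saddle_eq[OF d] by (intro continuous_intros)
  moreover have "weak_partial D i (\<lambda>x. c + b \<bullet> x + \<alpha> * saddle \<theta> z d x) (\<lambda>x. G x $ i)" for i
    using weak_partial_classical[OF D(1) saddle_has_derivative[OF d, of c b \<alpha> \<theta> z], of i] contG[of i]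
    by (simp add: inner_axis flip: G_def)
  moreover have "weak_partial D j (\<lambda>x. G x $ i) (\<lambda>x. H $ i $ j)" for i j
  proof -
    have "(G has_derivative (\<lambda>h. (2 * \<alpha>) *\<^sub>R (((\<theta> + 1) * (h \<bullet> d)) *\<^sub>R d - h))) (at x)" for x
      unfolding G_def by (auto intro!: derivative_eq_intros)
    from bounded_linear.has_derivative[OF bounded_linear_vec_nth this]
    have der: "((\<lambda>x. G x $ i) has_derivative
        (\<lambda>h. 2 * \<alpha> * ((\<theta> + 1) * (h \<bullet> d) * d $ i - h $ i))) (at x)" for x
      by simp
    have "2 * \<alpha> * ((\<theta> + 1) * (axis j 1 \<bullet> d) * d $ i - axis j 1 $ i) = H $ i $ j"
      by (simp add: H_def axial_def inner_axis') (simp add: axis_def algebra_simps)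
    then show ?thesis
      using weak_partial_classical[OF D(1) der, of j] by simp
  qed
  ultimately show ?thesis unfolding W2p_with_hessian_def H_def[symmetric]
    using in_Lp_continuous[OF D] contG by (auto intro!: exI[of _ G])
qed

lemma compact_cyl:
  fixes z :: "'a::euclidean_space"
  assumes "norm d = 1"
  shows "compact (cyl z d s h)"
proof -
  have "closed (cyl z d s h)" unfolding cyl_def perp_def
    by (intro closed_Collect_conj closed_Collect_le continuous_intros)
  moreover have "cyl z d s h \<subseteq> cball z (s + h)"
  proof
    fix x assume "x \<in> cyl z d s h"
    then show "x \<in> cball z (s + h)"
      using norm_le_perp[OF assms, of "x - z"] by (auto simp: cyl_def dist_norm norm_minus_commute)
  qed
  ultimately show ?thesis by (metis bounded_cball bounded_subset compact_eq_bounded_closed)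
qed

text \<open>If comparison failed, u minus the barrier would have a negative minimum over the compact
  cylinder. It would be attained in the interior, so the barrier would be an admissible test
  function there, although the Pucci operator is a positive constant on its Hessian.\<close>

lemma pucci_supersolution_saddle_comparison:
  fixes u :: "real^'n \<Rightarrow> real"
  assumes n: "CARD('n) \<ge> 2" and lam: "0 < lam" "lam \<le> Lam" and D: "open D" "bounded D"
    and u: "pucci_supersolution lam Lam D u"
  shows "saddle_comparison (real CARD('n) * Lam / lam) D u"
  unfolding saddle_comparison_def
proof (intro allI impI, elim conjE)
  define \<theta> where "\<theta> = real CARD('n) * Lam / lam"
  fix z d b :: "real^'n" and s h \<alpha> c :: real
  assume d: "norm d = 1" and al: "\<alpha> > 0" and sub: "cyl z d s h \<subseteq> D"
    and bdry: "\<forall>x\<in>cyl_bdry z d s h. c + b \<bullet> x + \<alpha> * saddle (real CARD('n) * Lam / lam) z d x \<le> u x"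
  define \<phi> where "\<phi> x = c + b \<bullet> x + \<alpha> * saddle \<theta> z d x" for x
  define H where "H = axial (- 2 * \<alpha>) (2 * \<alpha> * \<theta>) d"
  have contu: "continuous_on D u" using u by (simp add: pucci_supersolution_def)
  have contphi: "continuous_on S \<phi>" for S
    unfolding \<phi>_def saddle_eq[OF d] by (intro continuous_intros)
  have th: "\<theta> > 0" using lam by (simp add: \<theta>_def)
  have pos: "pucci_min lam Lam H > 0"
  proof -
    \<comment> \<open>With n the dimension, the choice of \<theta> gives 2 \<alpha> n Lam - 2
      \<alpha> (n - 1) Lam = 2 \<alpha> Lam.\<close>
    have "pucci_min lam Lam H = lam * (2 * \<alpha> * \<theta>) + Lam * (real (CARD('n) - 1) * (- 2 * \<alpha>))"
      unfolding H_def using al th by (intro pucci_min_axial[OF d n]) auto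
    also have "lam * (2 * \<alpha> * \<theta>) = 2 * \<alpha> * real CARD('n) * Lam" using lam by (simp add: \<theta>_def)
    finally have "pucci_min lam Lam H = 2 * \<alpha> * Lam"
      using n by (simp add: of_nat_diff algebra_simps)
    then show ?thesis using al lam by simp
  qed
  have "\<phi> x \<le> u x" if x: "x \<in> cyl z d s h" for x
  proof (rule ccontr)
    assume neg: "\<not> \<phi> x \<le> u x"
    have "continuous_on (cyl z d s h) (\<lambda>y. u y - \<phi> y)"
      using contu contphi sub by (intro continuous_on_diff) (auto intro: continuous_on_subset)
    then obtain y where y: "y \<in> cyl z d s h" and min: "\<And>w. w \<in> cyl z d s h \<Longrightarrow> u y - \<phi> y \<le> u w - \<phi> w"
      using continuous_attains_inf[OF compact_cyl[OF d], of z s h] x by blast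
    define U where "U = {w. norm (perp d (w - z)) < s} \<inter> {w. 0 < (w - z) \<bullet> d} \<inter> {w. (w - z) \<bullet> d < h}"
    have "open U" unfolding U_def perp_def
      by (intro open_Int open_Collect_less continuous_intros)
    moreover have "y \<in> U"
    proof -
      have "y \<notin> cyl_bdry z d s h" using bdry min[OF x] neg by (force simp: \<phi>_def \<theta>_def)
      then show ?thesis using y by (auto simp: cyl_bdry_def cyl_def U_def)
    qed
    moreover have "U \<subseteq> cyl z d s h" by (auto simp: U_def cyl_def)
    ultimately have "\<forall>\<^sub>F w in at y within D. u y - \<phi> y \<le> u w - \<phi> w"
      unfolding eventually_at_topological using min by blast
    then have "ess_liminf_at y (\<lambda>w. pucci_min lam Lam H) \<le> 0"
      using u[unfolded pucci_supersolution_def, THEN conjunct2, rule_format, of \<phi> "\<lambda>_. H" y]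
        W2p_saddle[OF D d, of _ c b \<alpha> \<theta> z] contphi y sub by (auto simp: \<phi>_def[abs_def] H_def)
    then show False using pos by (simp add: ess_liminf_at_const)
  qed
  then show "\<forall>x\<in>cyl z d s h. c + b \<bullet> x + \<alpha> * saddle (real CARD('n) * Lam / lam) z d x \<le> u x"
    by (simp add: \<phi>_def \<theta>_def)
qed

section \<open>Gain of slope from the region below the hyperplane\<close>

text \<open>At depth \<epsilon>/4 the excess of u over \<open>a * (x \<bullet> e)\<close> is at
  least a \<epsilon>/4 merely because u is nonnegative. \<open>spread_from_base\<close> lifts an
  eighth of this above the hyperplane, where \<open>hopf_from_ball\<close> converts it into extra
  slope; hence the factor 1/32.\<close>

lemma gain_from_lower_boundary:
  fixes \<theta> :: real
  assumes th: "\<theta> \<ge> 1"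
  obtains c where "c > 0"
    and "\<And>(u :: 'a::euclidean_space \<Rightarrow> real) e D a \<epsilon> x.
      DIM('a) \<ge> 2 \<Longrightarrow> norm e = 1 \<Longrightarrow> saddle_comparison \<theta> D u \<Longrightarrow> (\<And>x. x \<in> D \<Longrightarrow> u x \<ge> 0) \<Longrightarrow>
      half_ball e \<subseteq> D \<Longrightarrow>
      (\<And>x. norm x < 1 \<Longrightarrow> norm (perp e x) \<ge> 3/8 \<Longrightarrow> x \<bullet> e \<ge> - (\<epsilon> / 4) \<Longrightarrow> x \<in> D) \<Longrightarrow>
      a \<ge> 0 \<Longrightarrow> 0 < \<epsilon> \<Longrightarrow> \<epsilon> \<le> 1 / (32 * \<theta>) \<Longrightarrow> (\<And>x. x \<in> half_ball e \<Longrightarrow> u x \<ge> a * (x \<bullet> e)) \<Longrightarrow>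
      norm x < 1 / (8 * \<theta>) \<Longrightarrow> x \<bullet> e > 0 \<Longrightarrow> u x \<ge> a * (1 + c * \<epsilon>) * (x \<bullet> e)"
proof -
  \<comment> \<open>T is the cylinder height that \<open>spread_from_base\<close> prescribes for
    radius 1/8.\<close>
  define T where "T = 1 / (16 * \<theta>)"
  have T: "0 < T" "T \<le> 1/16" using th by (auto simp: T_def field_simps)
  define \<rho> where "\<rho> = T / 16"
  have rho: "\<rho> > 0" "\<rho> < 1 / (16 * \<theta>)" using T by (auto simp: \<rho>_def simp flip: T_def)
  obtain c where c: "c > 0" and hopf: "\<And>(v :: 'a \<Rightarrow> real) e z m x.
      saddle_comparison \<theta> (half_ball e) v \<Longrightarrow> norm e = 1 \<Longrightarrow> (\<And>x. x \<in> half_ball e \<Longrightarrow> v x \<ge> 0) \<Longrightarrow>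
      m \<ge> 0 \<Longrightarrow> cball z (2 * \<rho>) \<subseteq> half_ball e \<Longrightarrow> (\<And>x. x \<in> cball z \<rho> \<Longrightarrow> v x \<ge> m) \<Longrightarrow>
      norm x < 1 / (8 * \<theta>) \<Longrightarrow> x \<bullet> e > 0 \<Longrightarrow> v x \<ge> c * m * (x \<bullet> e)"
    using hopf_from_ball[OF th rho] by blast
  show ?thesis
  proof (rule that[of "c / 32"])
    show "c / 32 > 0" using c by simp
    fix u :: "'a \<Rightarrow> real" and e D a \<epsilon> x
    assume dim: "DIM('a) \<ge> 2" and e: "norm e = 1" and cmp: "saddle_comparison \<theta> D u"
      and nonneg: "\<And>x. x \<in> D \<Longrightarrow> u x \<ge> 0" and half: "half_ball e \<subseteq> D"
      and low: "\<And>x. norm x < 1 \<Longrightarrow> norm (perp e x) \<ge> 3/8 \<Longrightarrow> x \<bullet> e \<ge> - (\<epsilon> / 4) \<Longrightarrow> x \<in> D"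
      and a: "a \<ge> 0" and eps: "0 < \<epsilon>" "\<epsilon> \<le> 1 / (32 * \<theta>)"
      and above: "\<And>x. x \<in> half_ball e \<Longrightarrow> u x \<ge> a * (x \<bullet> e)"
      and x: "norm x < 1 / (8 * \<theta>)" "x \<bullet> e > 0"
    have ee: "e \<bullet> e = 1" using e by (simp add: dot_square_norm)
    have epsT: "\<epsilon> \<le> T / 2" using eps by (simp add: T_def)
    \<comment> \<open>Within 1/8 of y horizontal distances lie between 3/8 and 5/8: the lower bound
      makes \<open>low\<close> applicable, the upper one keeps the cylinder in the unit
      ball.\<close>
    obtain y where y: "norm y = 1/2" "y \<bullet> e = 0"
    proof -
      obtain w where w: "w \<noteq> 0" "orthogonal e w"
        using orthogonal_to_vector_exists[OF dim, of e] by blast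
      show ?thesis
        by (rule that[of "(1 / (2 * norm w)) *\<^sub>R w"])
          (use w in \<open>auto simp: orthogonal_def inner_commute\<close>)
    qed
    define v where "v x = u x - (a *\<^sub>R e) \<bullet> x" for x
    have v: "v x = u x - a * (x \<bullet> e)" for x by (simp add: v_def inner_commute)
    have cmpv: "saddle_comparison \<theta> D v"
      unfolding v_def[abs_def] by (rule saddle_comparison_diff_linear[OF cmp])
    define z where "z = y - (\<epsilon> / 4) *\<^sub>R e"
    have xe: "w \<bullet> e = (w - z) \<bullet> e - \<epsilon> / 4" for w using y ee by (simp add: z_def algebra_simps)
    have pz: "perp e (w - z) = perp e w - y" for w
      using y e by (simp add: z_def perp_diff perp_scaleR perp_self perp_eq_self)
    have in_cyl: "w \<in> D" "norm w < 1" if w: "w \<in> cyl z e (1/8) T" for w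
    proof -
      have p: "norm (perp e w - y) \<le> 1/8" using w by (simp add: cyl_def pz)
      have "norm y \<le> norm (perp e w) + norm (perp e w - y)"
        using norm_triangle_sub[of y "perp e w"] by (simp add: norm_minus_commute)
      then have lo: "norm (perp e w) \<ge> 3/8" using p y by simp
      have "norm (perp e w) \<le> 5/8" using norm_triangle_sub[of "perp e w" y] p y by simp
      moreover have "- (\<epsilon> / 4) \<le> w \<bullet> e" "w \<bullet> e \<le> T" using w eps by (auto simp: cyl_def xe[of w])
      ultimately show "norm w < 1" using norm_le_perp[OF e, of w] T epsT eps by (auto simp: abs_le_iff)
      then show "w \<in> D" using lo \<open>- (\<epsilon> / 4) \<le> w \<bullet> e\<close> by (intro low)
    qed
    \<comment> \<open>Below the hyperplane the subtracted linear function is nonpositive, so v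
      inherits the sign of u.\<close>
    have nonneg_v: "v w \<ge> 0" if "w \<in> D" "norm w < 1" for w
    proof (cases "w \<bullet> e > 0")
      case True
      then show ?thesis using above[of w] that by (simp add: half_ball_def v)
    next
      case False
      then have "a * (w \<bullet> e) \<le> 0" using a by (simp add: mult_nonneg_nonpos)
      then show ?thesis using nonneg[OF that(1)] by (simp add: v)
    qed
    have lifted: "v w \<ge> a * \<epsilon> / 4 / 8"
      if "norm (perp e (w - z)) \<le> 1/16" "0 \<le> (w - z) \<bullet> e" "(w - z) \<bullet> e \<le> T / 2" for w
    proof (rule spread_from_base[OF cmpv th e, of "1/8" _ z])
      have T_eq: "1 / 8 / (2 * \<theta>) = T" by (simp add: T_def)
      show "cyl z e (1/8) (1 / 8 / (2 * \<theta>)) \<subseteq> D" using in_cyl unfolding T_eq by auto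
      show "v w \<ge> 0" if "w \<in> cyl z e (1/8) (1 / 8 / (2 * \<theta>))" for w
        using in_cyl nonneg_v that unfolding T_eq by auto
      show "v w \<ge> a * \<epsilon> / 4" if "w \<in> cyl z e (1/8) (1 / 8 / (2 * \<theta>))" "(w - z) \<bullet> e = 0" for w
        using in_cyl(1)[of w] nonneg[of w] that unfolding T_eq v by (simp add: xe[of w])
    qed (use that a eps in \<open>auto simp: T_def\<close>)
    \<comment> \<open>p lies 3T/8 above the base disc and, as \<epsilon>/4 is at most T/8, at least
      T/4 above the hyperplane. So the ball of radius 2 \<rho> = T/8 about p lies in the half ball,
      and the one of radius \<rho> in the lifted region, which ends at height T/2.\<close>
    define p where "p = y + (3 * T / 8 - \<epsilon> / 4) *\<^sub>R e"
    have wz: "w - z = (w - p) + (3 * T / 8) *\<^sub>R e" for w by (simp add: p_def z_def algebra_simps)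
    have "v x \<ge> c * (a * \<epsilon> / 4 / 8) * (x \<bullet> e)"
    proof (rule hopf[OF saddle_comparison_subset[OF cmpv half] e])
      show "v w \<ge> 0" if "w \<in> half_ball e" for w
        using that half nonneg_v by (auto simp: half_ball_def)
      show "0 \<le> a * \<epsilon> / 4 / 8" using a eps by simp
      show "cball p (2 * \<rho>) \<subseteq> half_ball e"
      proof (rule cball_subset_half_ball[OF e])
        have "p \<bullet> e = 3 * T / 8 - \<epsilon> / 4" using y ee by (simp add: p_def inner_add_left)
        then show "p \<bullet> e > 2 * \<rho>" using epsT T by (simp add: \<rho>_def)
        have "norm p \<le> 1/2 + (3 * T / 8 - \<epsilon> / 4)"
          using norm_triangle_ineq[of y "(3 * T / 8 - \<epsilon> / 4) *\<^sub>R e"] y e epsT T by (simp add: p_def)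
        then show "norm p + 2 * \<rho> < 1" using T eps by (simp add: \<rho>_def)
      qed
      show "v w \<ge> a * \<epsilon> / 4 / 8" if "w \<in> cball p \<rho>" for w
      proof (rule lifted)
        have wp: "norm (w - p) \<le> \<rho>" using that by (simp add: dist_norm norm_minus_commute)
        then have "norm (perp e (w - p)) \<le> \<rho>" using norm_perp_le[OF e, of "w - p"] by linarith
        then show "norm (perp e (w - z)) \<le> 1/16"
          using T e by (simp add: wz perp_add perp_scaleR perp_self \<rho>_def)
        have "\<bar>(w - p) \<bullet> e\<bar> \<le> \<rho>" using abs_inner_le_norm[OF e, of "w - p"] wp by linarith
        moreover have "(w - z) \<bullet> e = (w - p) \<bullet> e + 3 * T / 8"
          unfolding wz using ee by (simp add: inner_add_left)
        ultimately show "0 \<le> (w - z) \<bullet> e" "(w - z) \<bullet> e \<le> T / 2" using T by (auto simp: \<rho>_def abs_le_iff)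
      qed
    qed (use x in auto)
    then show "u x \<ge> a * (1 + c / 32 * \<epsilon>) * (x \<bullet> e)" by (simp add: v algebra_simps)
  qed
qed

text \<open>Dilation by R reduces to \<open>gain_from_lower_boundary\<close> with slope
  \<open>a * R\<close> and \<epsilon> = \<open>\<omega> (R / 4)\<close>.\<close>

lemma gain_at_scale:
  fixes \<theta> :: real
  assumes th: "\<theta> \<ge> 1" and dim: "DIM('a::euclidean_space) \<ge> 2"
  obtains c where "c > 0"
    and "\<And>(u :: 'a \<Rightarrow> real) e D \<omega> a R x.
      norm e = 1 \<Longrightarrow> saddle_comparison \<theta> D u \<Longrightarrow> (\<And>x. x \<in> D \<Longrightarrow> u x \<ge> 0) \<Longrightarrow>
      mono_on {0..} \<omega> \<Longrightarrow> (\<And>r. r \<ge> 0 \<Longrightarrow> \<omega> r \<ge> 0) \<Longrightarrow>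
      (\<And>x. norm x < 1 \<Longrightarrow> x \<bullet> e > - norm (perp e x) * \<omega> (norm (perp e x)) \<Longrightarrow> x \<in> D) \<Longrightarrow>
      a \<ge> 0 \<Longrightarrow> 0 < R \<Longrightarrow> R \<le> 1 \<Longrightarrow> \<omega> (R / 4) \<le> 1 / (32 * \<theta>) \<Longrightarrow>
      (\<And>x. norm x < R \<Longrightarrow> x \<bullet> e > 0 \<Longrightarrow> u x \<ge> a * (x \<bullet> e)) \<Longrightarrow>
      norm x < R / (8 * \<theta>) \<Longrightarrow> x \<bullet> e > 0 \<Longrightarrow> u x \<ge> a * (1 + c * \<omega> (R / 4)) * (x \<bullet> e)"
proof -
  obtain c where c: "c > 0" and gain: "\<And>(u :: 'a \<Rightarrow> real) e D a \<epsilon> x.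
      DIM('a) \<ge> 2 \<Longrightarrow> norm e = 1 \<Longrightarrow> saddle_comparison \<theta> D u \<Longrightarrow> (\<And>x. x \<in> D \<Longrightarrow> u x \<ge> 0) \<Longrightarrow>
      half_ball e \<subseteq> D \<Longrightarrow>
      (\<And>x. norm x < 1 \<Longrightarrow> norm (perp e x) \<ge> 3/8 \<Longrightarrow> x \<bullet> e \<ge> - (\<epsilon> / 4) \<Longrightarrow> x \<in> D) \<Longrightarrow>
      a \<ge> 0 \<Longrightarrow> 0 < \<epsilon> \<Longrightarrow> \<epsilon> \<le> 1 / (32 * \<theta>) \<Longrightarrow> (\<And>x. x \<in> half_ball e \<Longrightarrow> u x \<ge> a * (x \<bullet> e)) \<Longrightarrow>
      norm x < 1 / (8 * \<theta>) \<Longrightarrow> x \<bullet> e > 0 \<Longrightarrow> u x \<ge> a * (1 + c * \<epsilon>) * (x \<bullet> e)"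
    using gain_from_lower_boundary[OF th] by blast
  show ?thesis
  proof (rule that[OF c])
    fix u :: "'a \<Rightarrow> real" and e D \<omega> a R x
    assume e: "norm e = 1" and cmp: "saddle_comparison \<theta> D u" and nonneg: "\<And>x. x \<in> D \<Longrightarrow> u x \<ge> 0"
      and mono: "mono_on {0..} \<omega>" and om: "\<And>r. r \<ge> 0 \<Longrightarrow> \<omega> r \<ge> 0"
      and dom: "\<And>x. norm x < 1 \<Longrightarrow> x \<bullet> e > - norm (perp e x) * \<omega> (norm (perp e x)) \<Longrightarrow> x \<in> D"
      and a: "a \<ge> 0" and R: "0 < R" "R \<le> 1" and small: "\<omega> (R / 4) \<le> 1 / (32 * \<theta>)"
      and above: "\<And>x. norm x < R \<Longrightarrow> x \<bullet> e > 0 \<Longrightarrow> u x \<ge> a * (x \<bullet> e)"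
      and x: "norm x < R / (8 * \<theta>)" "x \<bullet> e > 0"
    define \<epsilon> where "\<epsilon> = \<omega> (R / 4)"
    show "u x \<ge> a * (1 + c * \<omega> (R / 4)) * (x \<bullet> e)"
    \<comment> \<open>If \<epsilon> = 0 nothing is gained and the claim is the assumed bound on a
      larger ball.\<close>
    proof (cases "\<epsilon> = 0")
      case True
      have "R / (8 * \<theta>) \<le> R / 1" using th R by (intro divide_left_mono) auto
      then show ?thesis using above[of x] x True by (simp add: \<epsilon>_def)
    next
      case False
      then have eps: "\<epsilon> > 0" using om[of "R / 4"] R by (simp add: \<epsilon>_def)
      have Rx: "norm (R *\<^sub>R w) < R" if "norm w < 1" for w :: 'a
        using that R by simp
      have "u (R *\<^sub>R (x /\<^sub>R R)) \<ge> (a * R) * (1 + c * \<epsilon>) * ((x /\<^sub>R R) \<bullet> e)"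
      proof (rule gain[OF dim e saddle_comparison_scale[OF cmp R(1)], where \<epsilon> = \<epsilon>])
        show "half_ball e \<subseteq> {x. R *\<^sub>R x \<in> D}"
        proof
          fix w assume "w \<in> half_ball e"
          then have w: "norm w < 1" "w \<bullet> e > 0" by (auto simp: half_ball_def)
          have "(R *\<^sub>R w) \<bullet> e > 0" using w R by simp
          moreover have "norm (perp e (R *\<^sub>R w)) * \<omega> (norm (perp e (R *\<^sub>R w))) \<ge> 0"
            by (intro mult_nonneg_nonneg om) auto
          ultimately show "w \<in> {x. R *\<^sub>R x \<in> D}"
            using dom[of "R *\<^sub>R w"] less_le_trans[OF Rx[OF w(1)] R(2)] by simp
        qed
        show "w \<in> {x. R *\<^sub>R x \<in> D}"
          if w: "norm w < 1" "norm (perp e w) \<ge> 3/8" "w \<bullet> e \<ge> - (\<epsilon> / 4)" for w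
        proof -
          \<comment> \<open>At horizontal distance at least 3R/8, monotonicity gives a depth of at
            least 3R\<epsilon>/8, strictly more than the required R\<epsilon>/4.\<close>
          define \<xi> where "\<xi> = norm (perp e (R *\<^sub>R w))"
          have xi: "\<xi> \<ge> R * (3/8)" using w R by (simp add: \<xi>_def perp_scaleR)
          have "\<omega> \<xi> \<ge> \<epsilon>" unfolding \<epsilon>_def using xi R by (intro mono_onD[OF mono]) auto
          then have "\<xi> * \<omega> \<xi> \<ge> R * (3/8) * \<epsilon>" using xi R eps by (intro mult_mono) auto
          moreover have "(R *\<^sub>R w) \<bullet> e \<ge> R * (- (\<epsilon> / 4))"
            unfolding inner_scaleR_left using w R by (intro mult_left_mono) auto
          moreover have "R * \<epsilon> > 0" using R eps by simp
          ultimately have "(R *\<^sub>R w) \<bullet> e > - \<xi> * \<omega> \<xi>" by simp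
          then show ?thesis using dom[of "R *\<^sub>R w"] less_le_trans[OF Rx[OF w(1)] R(2)] by (simp add: \<xi>_def)
        qed
        show "u (R *\<^sub>R w) \<ge> a * R * (w \<bullet> e)" if "w \<in> half_ball e" for w
          using above[of "R *\<^sub>R w"] that R by (simp add: half_ball_def mult.assoc)
        show "norm (x /\<^sub>R R) < 1 / (8 * \<theta>)" using x R by (simp add: field_simps)
      qed (use nonneg a R eps small x in \<open>auto simp: \<epsilon>_def\<close>)
      moreover have "(a * R) * (1 + c * \<epsilon>) * ((x /\<^sub>R R) \<bullet> e) = a * (1 + c * \<epsilon>) * (x \<bullet> e)"
        using R by (simp add: field_simps)
      moreover have "R *\<^sub>R (x /\<^sub>R R) = x" using R by simp
      ultimately show ?thesis unfolding \<epsilon>_def by metis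
    qed
  qed
qed

section \<open>Divergence along geometric scales and the resulting rate\<close>

text \<open>By monotonicity, the integrand on the k-th geometric interval is at most \<omega> at the
  right end divided by the left end. The integral of this bound is \<omega> at the right end times
  1/\<eta> - 1, so a convergent series would make the Dini integral finite.\<close>

lemma dini_divergence_series:
  fixes \<omega> :: "real \<Rightarrow> real"
  assumes mono: "mono_on {0..} \<omega>" and nonneg: "\<And>r. r \<ge> 0 \<Longrightarrow> \<omega> r \<ge> 0"
    and div: "(\<integral>\<^sup>+r. ennreal (\<omega> r / r) * indicator {0<..<1} r \<partial>lborel) = \<infinity>"
    and eta: "0 < \<eta>" "\<eta> < 1" and s: "0 < s"
  shows "\<not> summable (\<lambda>k. \<omega> (s * \<eta> ^ k))"
proof
  assume sum: "summable (\<lambda>k. \<omega> (s * \<eta> ^ k))"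
  define b where "b k = s * \<eta> ^ k" for k
  have b: "b k > 0" "b (Suc k) = \<eta> * b k" for k using s eta by (auto simp: b_def)
  define f where "f r = ennreal (\<omega> 1 / s) * indicator {s..1} r
      + (\<Sum>k. ennreal (\<omega> (b k) / b (Suc k)) * indicator {b (Suc k)<..b k} r)" for r
  have le: "ennreal (\<omega> r / r) * indicator {0<..<1} r \<le> f r" for r
  proof (cases "r \<in> {0<..<1}")
    case True
    then have r: "0 < r" "r < 1" by auto
    show ?thesis
    proof (cases "r \<ge> s")
      case True
      have "\<omega> r / r \<le> \<omega> 1 / s"
        using True r s nonneg by (intro frac_le mono_onD[OF mono]) auto
      then have "ennreal (\<omega> r / r) \<le> ennreal (\<omega> 1 / s)" by (rule ennreal_leI)
      then show ?thesis using r True by (auto simp: f_def intro: add_increasing2)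
    next
      case False
      have "b \<longlonglongrightarrow> 0" unfolding b_def
        using eta by (auto intro!: tendsto_eq_intros LIMSEQ_power_zero)
      then have "\<exists>k. b k < r" using r
        by (metis eventually_sequentially order_refl order_tendstoD(2))
      \<comment> \<open>The least index with \<open>b k < r\<close> locates the interval containing
        r; it is not 0 because r < s = \<open>b 0\<close>.\<close>
      then have ex: "b (LEAST k. b k < r) < r" by (rule LeastI_ex)
      have "(LEAST k. b k < r) \<noteq> 0"
      proof
        assume "(LEAST k. b k < r) = 0"
        then show False using ex False by (simp add: b_def)
      qed
      then obtain k where k: "(LEAST k. b k < r) = Suc k" using not0_implies_Suc by blast
      have "\<not> b k < r" using not_less_Least[of k "\<lambda>k. b k < r"] k by simp
      then have rk: "b (Suc k) < r" "r \<le> b k" using ex k by auto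
      have "\<omega> r / r \<le> \<omega> (b k) / b (Suc k)"
        using rk r b(1)[of "Suc k"] b(1)[of k] nonneg by (intro frac_le mono_onD[OF mono]) auto
      then have "ennreal (\<omega> r / r) \<le> ennreal (\<omega> (b k) / b (Suc k)) * indicator {b (Suc k)<..b k} r"
        using rk by (simp add: ennreal_leI)
      also have "\<dots> \<le> (\<Sum>k. ennreal (\<omega> (b k) / b (Suc k)) * indicator {b (Suc k)<..b k} r)"
        using sum_le_suminf[OF summableI, of "{k}" "\<lambda>k. ennreal (\<omega> (b k) / b (Suc k)) * indicator {b (Suc k)<..b k} r"]
        by (simp del: sum_mult_indicator)
      finally show ?thesis using r by (auto simp: f_def intro: add_increasing)
    qed
  qed auto
  have piece: "(\<integral>\<^sup>+r. ennreal (\<omega> (b k) / b (Suc k)) * indicator {b (Suc k)<..b k} r \<partial>lborel)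
      = ennreal (\<omega> (b k) * (1 / \<eta> - 1))" for k
  proof -
    have "(\<integral>\<^sup>+r. ennreal (\<omega> (b k) / b (Suc k)) * indicator {b (Suc k)<..b k} r \<partial>lborel)
        = ennreal (\<omega> (b k) / b (Suc k)) * ennreal (b k - b (Suc k))"
      using b[of k] eta by (subst nn_integral_cmult_indicator) (auto simp: mult_left_le_one_le)
    also have "\<dots> = ennreal (\<omega> (b k) / b (Suc k) * (b k - b (Suc k)))"
      using b[of k] b(1)[of "Suc k"] eta nonneg[of "b k"]
      by (intro ennreal_mult[symmetric]) (auto simp: mult_left_le_one_le)
    also have "\<omega> (b k) / b (Suc k) * (b k - b (Suc k)) = \<omega> (b k) * (1 / \<eta> - 1)"
      using b[of k] eta by (simp add: field_simps)
    finally show ?thesis .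
  qed
  have "(\<integral>\<^sup>+r. f r \<partial>lborel) = ennreal (\<omega> 1 / s) * emeasure lborel {s..1}
      + (\<Sum>k. ennreal (\<omega> (b k) * (1 / \<eta> - 1)))"
    unfolding f_def
    by (subst nn_integral_add) (auto simp: nn_integral_suminf piece nn_integral_cmult_indicator)
  also have "(\<Sum>k. ennreal (\<omega> (b k) * (1 / \<eta> - 1))) = ennreal (\<Sum>k. \<omega> (b k) * (1 / \<eta> - 1))"
    using sum eta b(1) nonneg unfolding b_def
    by (intro suminf_ennreal2 mult_nonneg_nonneg summable_mult2) (auto simp: less_imp_le)
  also have "ennreal (\<omega> 1 / s) * emeasure lborel {s..1} + \<dots> < \<infinity>"
    by (simp add: ennreal_mult_less_top emeasure_lborel_Icc_eq)
  finally have "(\<integral>\<^sup>+r. f r \<partial>lborel) < \<infinity>" .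
  moreover have "(\<integral>\<^sup>+r. ennreal (\<omega> r / r) * indicator {0<..<1} r \<partial>lborel) \<le> (\<integral>\<^sup>+r. f r \<partial>lborel)"
    by (intro nn_integral_mono le)
  ultimately show False using div by simp
qed

text \<open>For nonnegative terms, expanding the product shows that it dominates 1 plus the partial
  sum.\<close>

lemma prod_one_plus_unbounded:
  fixes x :: "nat \<Rightarrow> real"
  assumes "\<And>k. x k \<ge> 0" and "\<not> summable x"
  shows "\<exists>k. (\<Prod>j<k. 1 + x j) > K"
proof -
  have ge: "(\<Prod>j<k. 1 + x j) \<ge> 1 + (\<Sum>j<k. x j)" for k
  proof (induction k)
    case (Suc k)
    have "1 * x k \<le> (\<Prod>j<k. 1 + x j) * x k"
      using assms(1) by (intro mult_right_mono prod_ge_1) auto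
    then show ?case using Suc by (simp add: distrib_left)
  qed simp
  have "\<exists>n. (\<Sum>j\<le>n. x j) > K"
    using assms bounded_imp_summable[of x K] by (meson not_le)
  then obtain n where "(\<Sum>j<Suc n. x j) > K" by (auto simp: lessThan_Suc_atMost)
  then show ?thesis using ge[of "Suc n"] by (intro exI[of _ "Suc n"]) linarith
qed

text \<open>The rate is a step function: at r it takes the value of A at the last scale whose radius
  still exceeds r.\<close>

lemma rate_from_scales:
  fixes A R :: "nat \<Rightarrow> real"
  assumes A: "incseq A" "A 0 > 0" "\<And>K. \<exists>k. A k > K" and R: "decseq R" "R \<longlonglongrightarrow> 0"
    and RP: "\<And>k. R k > 0"
  obtains w where "\<And>r. 0 < r \<Longrightarrow> r < R 0 \<Longrightarrow> w r > 0 \<and> (\<exists>k. w r = A k \<and> r < R k)"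
    and "filterlim w at_top (at_right 0)"
proof -
  \<comment> \<open>The shift to \<open>Suc k\<close> selects the last index with r <
    \<open>R k\<close>, for 0 < r < \<open>R 0\<close>.\<close>
  define k where "k r = (LEAST k. R (Suc k) \<le> r)" for r
  have k: "R (Suc (k r)) \<le> r" if "r > 0" for r
  proof -
    have "\<forall>\<^sub>F n in sequentially. R n < r" using order_tendstoD(2)[OF R(2) that] .
    then obtain n where "\<And>m. m \<ge> n \<Longrightarrow> R m < r" by (auto simp: eventually_sequentially)
    then have "R (Suc n) \<le> r" by (simp add: less_imp_le)
    then show ?thesis unfolding k_def by (rule LeastI)
  qed
  have below: "r < R (k r)" if "r < R 0" for r
  proof (cases "k r")
    case (Suc j)
    then have "\<not> R (Suc j) \<le> r" using not_less_Least[of j "\<lambda>k. R (Suc k) \<le> r"] by (simp add: k_def)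
    then show ?thesis using Suc by simp
  qed (use that in simp)
  have Apos: "A j > 0" for j using A(2) incseqD[OF A(1), of 0 j] by simp
  show ?thesis
  proof (rule that[of "\<lambda>r. A (k r)"])
    show "A (k r) > 0 \<and> (\<exists>j. A (k r) = A j \<and> r < R j)" if "0 < r" "r < R 0" for r
      using Apos below[OF that(2)] by blast
    show "filterlim (\<lambda>r. A (k r)) at_top (at_right 0)"
      unfolding filterlim_at_top_gt[where c = 0]
    proof (intro allI impI)
      fix K :: real
      obtain j where j: "A j > K" using A(3) by blast
      have "K \<le> A (k r)" if r: "0 < r" "r < R (Suc j)" for r
      proof -
        have "R (Suc (k r)) < R (Suc j)" using k[OF r(1)] r by simp
        then have "\<not> Suc (k r) \<le> Suc j" using decseqD[OF R(1), of "Suc (k r)" "Suc j"] by auto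
        then have "A j \<le> A (k r)" by (intro incseqD[OF A(1)]) simp
        then show ?thesis using j by simp
      qed
      then show "\<forall>\<^sub>F r in at_right 0. K \<le> A (k r)"
        using RP[of "Suc j"] by (auto simp: eventually_at_right_field)
    qed
  qed
qed

section \<open>Iteration of the slope gain over shrinking half balls\<close>

theorem theorem1p15:
  fixes lam Lam :: real and \<omega> :: "real \<Rightarrow> real"
  assumes "CARD('n::finite) \<ge> 2"
    and "0 < lam" and "lam \<le> Lam"
    and "\<omega> 1 < 1/4"
  shows "\<exists>\<delta>>0. \<exists>\<omega>' :: real \<Rightarrow> real.
    (\<forall>r. 0 < r \<and> r < \<delta> \<longrightarrow> \<omega>' r > 0) \<and>
    filterlim \<omega>' at_top (at_right 0) \<and>
    (\<forall>(\<Omega> :: (real^'n) set) (e :: real^'n) (u :: real^'n \<Rightarrow> real).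
       open \<Omega> \<and> connected \<Omega> \<and> 0 \<in> frontier \<Omega> \<and>
       anti_exterior_C1Dini e 1 \<omega> \<Omega> \<and>
       pucci_supersolution lam Lam (\<Omega> \<inter> ball 0 1) u \<and>
       u 0 = 0 \<and> (\<forall>x \<in> \<Omega> \<inter> ball 0 1. u x \<ge> 0) \<longrightarrow>
       (\<forall>l :: real^'n. norm l = 1 \<and> l \<bullet> e > 0 \<longrightarrow>
          (\<forall>r. 0 < r \<and> r < \<delta> \<longrightarrow>
             u (r *\<^sub>R l) \<ge> (l \<bullet> e) * (INF x\<in>ball (e /\<^sub>R 2) (1/8). u x) * r * \<omega>' r)))"
proof (cases "mono_on {0..} \<omega> \<and> (\<forall>r\<ge>0. \<omega> r \<ge> 0) \<and> (\<omega> \<longlongrightarrow> 0) (at_right 0) \<and>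
     (\<integral>\<^sup>+r. ennreal (\<omega> r / r) * indicator {0<..<1} r \<partial>lborel) = \<infinity>")
  \<comment> \<open>No domain satisfies the condition with such \<omega>, so the estimate is vacuous
    and any positive function with the right limit serves.\<close>
  case False
  show ?thesis
  proof (intro exI[of _ 1] conjI exI[of _ inverse])
    show "filterlim inverse at_top (at_right (0::real))" by (rule filterlim_inverse_at_top_right)
  qed (use False in \<open>auto simp: anti_exterior_C1Dini_def\<close>)
next
  case True
  then have mono: "mono_on {0..} \<omega>" and om: "\<And>r. r \<ge> 0 \<Longrightarrow> \<omega> r \<ge> 0" and lim: "(\<omega> \<longlongrightarrow> 0) (at_right 0)"
    and div: "(\<integral>\<^sup>+r. ennreal (\<omega> r / r) * indicator {0<..<1} r \<partial>lborel) = \<infinity>" by auto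
  define \<theta> where "\<theta> = real CARD('n) * Lam / lam"
  have th: "\<theta> \<ge> 1"
  proof -
    have "1 * lam \<le> real CARD('n) * Lam" using assms by (intro mult_mono) auto
    then show ?thesis using assms(2) by (simp add: \<theta>_def)
  qed
  have dim: "DIM(real^'n) \<ge> 2" using assms(1) by simp
  define \<eta> where "\<eta> = 1 / (8 * \<theta>)"
  have eta: "0 < \<eta>" "\<eta> < 1" using th by (auto simp: \<eta>_def)
  define \<rho> where "\<rho> = 1 / (32 * \<theta>)"
  have rho: "\<rho> > 0" "\<rho> < 1 / (16 * \<theta>)" "\<rho> \<le> 1/32" using th by (auto simp: \<rho>_def divide_simps)
  \<comment> \<open>\<open>c0\<close> and \<open>c\<close> are fixed before the domain, the
    direction and u, so they depend only on the dimension and the ellipticity constants.\<close>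
  obtain c0 where c0: "c0 > 0" and hopf: "\<And>(v :: real^'n \<Rightarrow> real) e z m x.
      saddle_comparison \<theta> (half_ball e) v \<Longrightarrow> norm e = 1 \<Longrightarrow> (\<And>x. x \<in> half_ball e \<Longrightarrow> v x \<ge> 0) \<Longrightarrow>
      m \<ge> 0 \<Longrightarrow> cball z (2 * \<rho>) \<subseteq> half_ball e \<Longrightarrow> (\<And>x. x \<in> cball z \<rho> \<Longrightarrow> v x \<ge> m) \<Longrightarrow>
      norm x < 1 / (8 * \<theta>) \<Longrightarrow> x \<bullet> e > 0 \<Longrightarrow> v x \<ge> c0 * m * (x \<bullet> e)"
    using hopf_from_ball[OF th rho(1,2)] by blast
  obtain c where c: "c > 0" and gain: "\<And>(u :: real^'n \<Rightarrow> real) e D \<omega> a R x.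
      norm e = 1 \<Longrightarrow> saddle_comparison \<theta> D u \<Longrightarrow> (\<And>x. x \<in> D \<Longrightarrow> u x \<ge> 0) \<Longrightarrow>
      mono_on {0..} \<omega> \<Longrightarrow> (\<And>r. r \<ge> 0 \<Longrightarrow> \<omega> r \<ge> 0) \<Longrightarrow>
      (\<And>x. norm x < 1 \<Longrightarrow> x \<bullet> e > - norm (perp e x) * \<omega> (norm (perp e x)) \<Longrightarrow> x \<in> D) \<Longrightarrow>
      a \<ge> 0 \<Longrightarrow> 0 < R \<Longrightarrow> R \<le> 1 \<Longrightarrow> \<omega> (R / 4) \<le> 1 / (32 * \<theta>) \<Longrightarrow>
      (\<And>x. norm x < R \<Longrightarrow> x \<bullet> e > 0 \<Longrightarrow> u x \<ge> a * (x \<bullet> e)) \<Longrightarrow>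
      norm x < R / (8 * \<theta>) \<Longrightarrow> x \<bullet> e > 0 \<Longrightarrow> u x \<ge> a * (1 + c * \<omega> (R / 4)) * (x \<bullet> e)"
    using gain_at_scale[OF th dim] by blast
  obtain t where t: "t > 0" "\<And>r. 0 < r \<Longrightarrow> r < t \<Longrightarrow> \<omega> r < \<rho>"
    using order_tendstoD(2)[OF lim rho(1)] by (auto simp: eventually_at_right_field)
  \<comment> \<open>R0 \<le> t keeps \<omega> below the threshold of \<open>gain\<close> at every
    scale, and R0 \<le> \<eta> places the first half ball where the Hopf bound holds.\<close>
  define R0 where "R0 = min t \<eta>"
  have R0: "0 < R0" "R0 \<le> t" "R0 \<le> \<eta>" using t eta by (auto simp: R0_def)
  define R where "R k = R0 * \<eta> ^ k" for k
  have pow: "0 < \<eta> ^ k" "\<eta> ^ k \<le> 1" for k using eta by (auto simp: power_le_one)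
  have R: "0 < R k" "R k \<le> R0" "R (Suc k) = R k / (8 * \<theta>)" "R (Suc k) \<le> R k" for k
  proof -
    show "0 < R k" "R k \<le> R0" "R (Suc k) = R k / (8 * \<theta>)"
      using pow[of k] R0 by (auto simp: R_def mult_left_le \<eta>_def)
    show "R (Suc k) \<le> R k" using R0 eta by (simp add: R_def mult_left_le_one_le)
  qed
  have small: "\<omega> (R k / 4) \<le> 1 / (32 * \<theta>)" for k
    using t(2)[of "R k / 4"] R[of k] R0 by (simp add: \<rho>_def)
  have om_R: "\<omega> (R k / 4) \<ge> 0" for k using R(1)[of k] by (intro om) simp
  \<comment> \<open>\<open>A k\<close> is the slope reached on the half ball of radius
    \<open>R k\<close>, in units of the infimum of u: the Hopf constant times the gains of the first
    k steps.\<close>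
  define A where "A k = c0 * (\<Prod>j<k. 1 + c * \<omega> (R j / 4))" for k
  have A_Suc: "A (Suc k) = A k * (1 + c * \<omega> (R k / 4))" for k by (simp add: A_def)
  have A_pos: "A k > 0" for k
    using c0 c om_R by (auto simp: A_def intro!: mult_pos_pos prod_pos add_pos_nonneg)
  have A_mono: "incseq A"
    using A_pos c om_R by (intro incseq_SucI) (simp add: A_Suc distrib_left less_imp_le)
  have A_unbdd: "\<exists>k. A k > K" for K
  proof -
    have "\<not> summable (\<lambda>k. \<omega> (R0 / 4 * \<eta> ^ k))"
      using R0 by (intro dini_divergence_series[OF mono om div eta]) auto
    then have "\<not> summable (\<lambda>k. c * \<omega> (R k / 4))"
      using c by (simp add: summable_cmult_iff R_def)
    then obtain k where "(\<Prod>j<k. 1 + c * \<omega> (R j / 4)) > K / c0"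
      using prod_one_plus_unbounded[of "\<lambda>k. c * \<omega> (R k / 4)" "K / c0"] c om_R by auto
    then show ?thesis using c0 by (auto simp: A_def field_simps)
  qed
  have R_lim: "R \<longlonglongrightarrow> 0" unfolding R_def
    using eta by (auto intro!: tendsto_eq_intros LIMSEQ_power_zero)
  obtain w where w: "\<And>r. 0 < r \<Longrightarrow> r < R 0 \<Longrightarrow> w r > 0 \<and> (\<exists>k. w r = A k \<and> r < R k)"
      and w_lim: "filterlim w at_top (at_right 0)"
    using rate_from_scales[OF A_mono A_pos A_unbdd decseq_SucI R_lim R(1)] R(4) by blast
  have growth: "u x \<ge> (INF x\<in>ball (e /\<^sub>R 2) (1/8). u x) * A k * (x \<bullet> e)"
    if ext: "open \<Omega>" "anti_exterior_C1Dini e 1 \<omega> \<Omega>"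
      and super: "pucci_supersolution lam Lam (\<Omega> \<inter> ball 0 1) u"
      and nonneg: "\<And>x. x \<in> \<Omega> \<inter> ball 0 1 \<Longrightarrow> u x \<ge> 0"
      and x: "norm x < R k" "x \<bullet> e > 0" for \<Omega> :: "(real^'n) set" and e u x k
  proof -
    define D where "D = \<Omega> \<inter> ball 0 1"
    define m where "m = (INF x\<in>ball (e /\<^sub>R 2) (1/8). u x)"
    have e: "norm e = 1" using ext by (simp add: anti_exterior_C1Dini_def)
    have nonneg': "\<And>x. x \<in> D \<Longrightarrow> u x \<ge> 0" using nonneg by (simp add: D_def)
    have cmp: "saddle_comparison \<theta> D u"
      unfolding \<theta>_def using ext(1) super assms
      by (intro pucci_supersolution_saddle_comparison) (auto simp: D_def)
    have dom: "x \<in> D" if "norm x < 1" "x \<bullet> e > - norm (perp e x) * \<omega> (norm (perp e x))" for x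
      using ext(2) that by (auto simp: anti_exterior_C1Dini_def D_def perp_def)
    have half: "half_ball e \<subseteq> D"
    proof
      fix x assume "x \<in> half_ball e"
      moreover have "norm (perp e x) * \<omega> (norm (perp e x)) \<ge> 0" by (intro mult_nonneg_nonneg om) auto
      ultimately show "x \<in> D" by (intro dom) (auto simp: half_ball_def)
    qed
    have ball_half: "cball (e /\<^sub>R 2) r \<subseteq> half_ball e" if "r < 1/2" for r
      using that e by (intro cball_subset_half_ball) (auto simp: dot_square_norm)
    have ball_D: "ball (e /\<^sub>R 2) (1/8) \<subseteq> D"
      by (rule order_trans[OF ball_subset_cball order_trans[OF ball_half half]]) simp
    have m: "m \<ge> 0" unfolding m_def using ball_D nonneg' by (intro cINF_greatest) auto
    \<comment> \<open>Nonnegativity of u bounds the values below, as the real infimum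
      requires.\<close>
    have m_le: "m \<le> u x" if "x \<in> ball (e /\<^sub>R 2) (1/8)" for x
      unfolding m_def using that ball_D nonneg' by (intro cINF_lower bdd_belowI2[of _ 0]) auto
    \<comment> \<open>The Hopf lemma, started from the ball about e/2, gives the first slope; each
      application of \<open>gain\<close> on radius \<open>R k\<close> gives the next one on radius
      \<open>R (Suc k)\<close>.\<close>
    have "u x \<ge> m * A k * (x \<bullet> e)" if "norm x < R k" "x \<bullet> e > 0" for x
      using that
    proof (induction k arbitrary: x)
      case 0
      have "u x \<ge> c0 * m * (x \<bullet> e)"
      proof (rule hopf[OF saddle_comparison_subset[OF cmp half] e _ m ball_half])
        show "u x \<ge> m" if "x \<in> cball (e /\<^sub>R 2) \<rho>" for x using that rho by (intro m_le) auto
      qed (use half nonneg' rho 0 R0 in \<open>auto simp: R_def \<eta>_def\<close>)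
      then show ?case by (simp add: A_def mult.commute)
    next
      case (Suc k)
      have "u x \<ge> m * A k * (1 + c * \<omega> (R k / 4)) * (x \<bullet> e)"
        using m A_pos[of k] R[of k] R0 eta small Suc
        by (intro gain[OF e cmp nonneg' mono om dom]) auto
      then show ?case by (simp add: A_Suc mult.assoc)
    qed
    then show ?thesis using x by (simp add: m_def)
  qed
  show ?thesis
  proof (intro exI[of _ "R 0"] exI[of _ w] conjI allI impI)
    fix \<Omega> :: "(real^'n) set" and e l u r
    assume *: "open \<Omega> \<and> connected \<Omega> \<and> 0 \<in> frontier \<Omega> \<and> anti_exterior_C1Dini e 1 \<omega> \<Omega> \<and>
       pucci_supersolution lam Lam (\<Omega> \<inter> ball 0 1) u \<and>
       u 0 = 0 \<and> (\<forall>x \<in> \<Omega> \<inter> ball 0 1. u x \<ge> 0)"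
      and l: "norm l = 1 \<and> l \<bullet> e > 0" and r: "0 < r \<and> r < R 0"
    \<comment> \<open>The point \<open>r *\<^sub>R l\<close> has norm r < \<open>R k\<close> and
      height \<open>r * (l \<bullet> e)\<close>, so the bound at scale k applies.\<close>
    then obtain k where "w r = A k" "r < R k" using w by blast
    then show "u (r *\<^sub>R l) \<ge> (l \<bullet> e) * (INF x\<in>ball (e /\<^sub>R 2) (1/8). u x) * r * w r"
      using growth[of \<Omega> e u "r *\<^sub>R l" k] * l r by (simp add: algebra_simps)
  qed (use R w w_lim in auto)
qed

end
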